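(* Let $F=\langle K,v_1,v_2,\tau\rangle$ be a sequential scrip bargaining with $k=|K|$ items, and let $\varepsilon=\frac{1}{R\,2^k}$ with $R\ge4$ an even integer (high budget resolution). Then $\langle F,\varepsilon\rangle$ has a Bottom Equilibrium $\gamma$ such that $\mu_\gamma$ is a monotone and surjective mapping from $\mathcal B_\varepsilon$ to $T_P(K)$.
   Context: A (two-player) sequential scrip bargaining (SSB) is $F=\langle K,v_1,v_2,\tau\rangle$, where $K$ is a finite set of $k$ items, $v_i:2^K\to\mathbb R$ is the value function of agent $i\in\{1,2\}$, and $\tau$ is a permutation of $K$ giving the order in which items are offered. Budgets and bids lie in $\mathcal B_\varepsilon=\{0,\varepsilon,\dots,1\}$; the agents start with budgets $B_1,B_2$, $B_1+B_2=1$. In each turn the agents simultaneously bid at most their current budgets for the current item; the higher bidder wins (agent 1 wins ties), pays her bid to the other agent, and decides which of the two agents gets the item. The budget has no value in itself: if the final allocation is $(K^1,K^2)$ (a partition of $K$), agent $i$'s utility is $v_i(K^i)$. As a bidding game: states are the partial allocations $s$ of the first $d$ items ($0\le d\le k$), $s_0$ is the empty allocation, $g(s)$ consists of the two allocations obtained by giving the next item to agent 1 or agent 2, and terminals are the full allocations, with $u_i(K^1,K^2)=v_i(K^i)$. Preferences: $t\succ_i t'$ iff $u_i(t)>u_i(t')$, or $u_i(t)=u_i(t')$ and $u_{-i}(t)>u_{-i}(t')$; allocations with the same pair of utilities are regarded as the same outcome, so each $\succ_i$ is a strict linear order on outcomes; $\succeq_i$ is its weak version. $T_P(K)$ is the set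 of Pareto-efficient allocations: those $t$ for which there is no allocation $t'$ with $t'\succ_1 t$ and $t'\succ_2 t$. A strategy profile $\gamma$ specifies bids and next states (who gets the item if one wins) of both agents for every nonterminal state $s$ and every budget $B_1\in\mathcal B_\varepsilon$ (with $B_2=1-B_1$). $\mu_\gamma(B_1)$ is the final allocation when $\gamma$ is played from $s_0$ with initial budget $B_1$ of agent 1. $\gamma$ is a pure subgame-perfect equilibrium (PSPE) if for every $(s,B_1)$ each agent best-responds to the other (with respect to $\succ_i$) in the subgame from $(s,B_1)$. $\mu_\gamma$ is monotone if $\mu_\gamma(B_1')\succeq_1\mu_\gamma(B_1)$ whenever $B_1'>B_1$, and likewise for agent 2 (her outcome weakly improves as $B_2$ increases). Order $\pi$ on profiles (compares only bids; equilibria with the same bids everywhere are identified). (1) For fixed $(s,B_1)$ with bids $(b_1,b_2)$ in $\gamma$ and $(b_1',b_2')$ in $\gamma'$: $\gamma'(s,B_1)>_\pi\gamma(s,B_1)$ if (i) $\max\{b_1',b_2'\}>\max\{b_1,b_2\}$; or (ii) the winning (higher) bids are equal and the losing bid in $\gamma'$ is lower; or (iii) $b_1'=b_2>b_1=b_2'$. (2) $\gamma'_s>_\pi\gamma_s$ if $\gamma'(s,B_1)\ge_\pi\gamma(s,B_1)$ for all $B_1\in\mathcal B_\varepsilon$ with at least one strict inequality. (3) Recursively, $\gamma'=_{\sigma(t)}\gamma$ for terminals $t$; for nonterminal $s$, $\gamma'>_{\sigma(s)}\gamma$ if $\gamma'\ge_{\sigma(s')}\gamma$ for all $s'\in g(s)$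 and either $\gamma'>_{\sigma(s')}\gamma$ for some $s'\in g(s)$ or $\gamma'_s>_\pi\gamma_s$. (4) $\gamma'>_\pi\gamma$ if $\gamma'>_{\sigma(s_0)}\gamma$. A Bottom Equilibrium is the (unique) minimum of $\pi$ on the set of PSPEs. *)

theory Defs
  imports Complex_Main
begin

section \<open>Sequential scrip bargaining\<close>

datatype agent = Ag1 | Ag2

fun other :: "agent \<Rightarrow> agent" where
  "other Ag1 = Ag2"
| "other Ag2 = Ag1"

text \<open>The permutation \<open>tau\<close> of the items is the list of the items in the order in which they
  are offered.\<close>

record 'a ssb =
  items :: "'a set"
  val :: "agent \<Rightarrow> 'a set \<Rightarrow> real"
  tau :: "'a list"

definition ssb :: "'a ssb \<Rightarrow> bool" where
  "ssb F \<longleftrightarrow> finite (items F) \<and> distinct (tau F) \<and> set (tau F) = items F"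

type_synonym 'a alloc = "agent \<Rightarrow> 'a set"

definition allocated :: "'a alloc \<Rightarrow> 'a set" where
  "allocated s = s Ag1 \<union> s Ag2"

definition states :: "'a ssb \<Rightarrow> 'a alloc set" where
  "states F = {s. s Ag1 \<inter> s Ag2 = {} \<and>
                  (\<exists>d \<le> card (items F). allocated s = set (take d (tau F)))}"

definition terminals :: "'a ssb \<Rightarrow> 'a alloc set" where
  "terminals F = {s \<in> states F. allocated s = items F}"

definition nonterminals :: "'a ssb \<Rightarrow> 'a alloc set" where
  "nonterminals F = states F - terminals F"

definition init_state :: "'a alloc" where
  "init_state = (\<lambda>i. {})"

definition next_item :: "'a ssb \<Rightarrow> 'a alloc \<Rightarrow> 'a" where
  "next_item F s = tau F ! card (allocated s)"

definition give :: "'a \<Rightarrow> agent \<Rightarrow> 'a alloc \<Rightarrow> 'a alloc" where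
  "give x i s = s(i := insert x (s i))"

definition next_states :: "'a ssb \<Rightarrow> 'a alloc \<Rightarrow> 'a alloc set" where
  "next_states F s = range (\<lambda>i. give (next_item F s) i s)"

section \<open>Preferences over full allocations\<close>

definition utility :: "'a ssb \<Rightarrow> agent \<Rightarrow> 'a alloc \<Rightarrow> real" where
  "utility F i t = val F i (t i)"

definition same_outcome :: "'a ssb \<Rightarrow> 'a alloc \<Rightarrow> 'a alloc \<Rightarrow> bool" where
  "same_outcome F t t' \<longleftrightarrow> (\<forall>i. utility F i t = utility F i t')"

definition prefers :: "'a ssb \<Rightarrow> agent \<Rightarrow> 'a alloc \<Rightarrow> 'a alloc \<Rightarrow> bool" where
  "prefers F i t t' \<longleftrightarrow> utility F i t > utility F i t' \<or>
     utility F i t = utility F i t' \<and> utility F (other i) t > utility F (other i) t'"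

definition weakly_prefers :: "'a ssb \<Rightarrow> agent \<Rightarrow> 'a alloc \<Rightarrow> 'a alloc \<Rightarrow> bool" where
  "weakly_prefers F i t t' \<longleftrightarrow> prefers F i t t' \<or> same_outcome F t t'"

definition pareto_efficient :: "'a ssb \<Rightarrow> 'a alloc set" where
  "pareto_efficient F =
     {t \<in> terminals F. \<not> (\<exists>t' \<in> terminals F. prefers F Ag1 t' t \<and> prefers F Ag2 t' t)}"

section \<open>Budgets, strategies and play\<close>

text \<open>Only the budget \<open>B\<close> of \<open>Ag1\<close> is recorded; \<open>Ag2\<close> holds \<open>1 - B\<close>.\<close>

definition budgets :: "real \<Rightarrow> real set" where
  "budgets \<epsilon> = {B. B \<le> 1 \<and> (\<exists>j::nat. B = real j * \<epsilon>)}"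

fun budget_of :: "agent \<Rightarrow> real \<Rightarrow> real" where
  "budget_of Ag1 B = B"
| "budget_of Ag2 B = 1 - B"

text \<open>A strategy gives, at a state and a budget of \<open>Ag1\<close>, the bid and the state that is chosen
  if the bid wins.\<close>

record 'a strategy =
  bid :: "'a alloc \<Rightarrow> real \<Rightarrow> real"
  dest :: "'a alloc \<Rightarrow> real \<Rightarrow> 'a alloc"

type_synonym 'a profile = "agent \<Rightarrow> 'a strategy"

definition is_strategy :: "'a ssb \<Rightarrow> real \<Rightarrow> agent \<Rightarrow> 'a strategy \<Rightarrow> bool" where
  "is_strategy F \<epsilon> i \<sigma> \<longleftrightarrow>
     (\<forall>s \<in> nonterminals F. \<forall>B \<in> budgets \<epsilon>.
        bid \<sigma> s B \<in> budgets \<epsilon> \<and> bid \<sigma> s B \<le> budget_of i B \<and> dest \<sigma> s B \<in> next_states F s)"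

fun turn :: "'a profile \<Rightarrow> 'a alloc \<times> real \<Rightarrow> 'a alloc \<times> real" where
  "turn \<gamma> (s, B) =
     (if bid (\<gamma> Ag1) s B \<ge> bid (\<gamma> Ag2) s B
      then (dest (\<gamma> Ag1) s B, B - bid (\<gamma> Ag1) s B)
      else (dest (\<gamma> Ag2) s B, B + bid (\<gamma> Ag2) s B))"

text \<open>Each turn allocates exactly one item, so that play from \<open>s\<close> lasts for as many turns as
  there are unallocated items.\<close>

definition outcome :: "'a ssb \<Rightarrow> 'a profile \<Rightarrow> 'a alloc \<Rightarrow> real \<Rightarrow> 'a alloc" where
  "outcome F \<gamma> s B = fst ((turn \<gamma> ^^ card (items F - allocated s)) (s, B))"

definition mu :: "'a ssb \<Rightarrow> 'a profile \<Rightarrow> real \<Rightarrow> 'a alloc" where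
  "mu F \<gamma> B = outcome F \<gamma> init_state B"

definition pspe :: "'a ssb \<Rightarrow> real \<Rightarrow> 'a profile \<Rightarrow> bool" where
  "pspe F \<epsilon> \<gamma> \<longleftrightarrow>
     (\<forall>i. is_strategy F \<epsilon> i (\<gamma> i)) \<and>
     (\<forall>s \<in> states F. \<forall>B \<in> budgets \<epsilon>. \<forall>i \<sigma>. is_strategy F \<epsilon> i \<sigma> \<longrightarrow>
        weakly_prefers F i (outcome F \<gamma> s B) (outcome F (\<gamma>(i := \<sigma>)) s B))"

section \<open>The order \<open>\<pi>\<close> and Bottom Equilibria\<close>

text \<open>All relations below compare only bids, so that the \<open>eq\<close> relations identify profiles that
  differ merely in the chosen next states. In each of them the first profile is the greater one.\<close>

definition bids_eq :: "'a profile \<Rightarrow> 'a profile \<Rightarrow> 'a alloc \<Rightarrow> real \<Rightarrow> bool" where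
  "bids_eq \<gamma>' \<gamma> s B \<longleftrightarrow> (\<forall>i. bid (\<gamma>' i) s B = bid (\<gamma> i) s B)"

definition bids_gt :: "'a profile \<Rightarrow> 'a profile \<Rightarrow> 'a alloc \<Rightarrow> real \<Rightarrow> bool" where
  "bids_gt \<gamma>' \<gamma> s B \<longleftrightarrow>
     (let b1 = bid (\<gamma> Ag1) s B; b2 = bid (\<gamma> Ag2) s B;
          b1' = bid (\<gamma>' Ag1) s B; b2' = bid (\<gamma>' Ag2) s B
      in max b1' b2' > max b1 b2 \<or>
         max b1' b2' = max b1 b2 \<and> min b1' b2' < min b1 b2 \<or>
         b1' = b2 \<and> b2 > b1 \<and> b1 = b2')"

definition state_eq :: "real \<Rightarrow> 'a profile \<Rightarrow> 'a profile \<Rightarrow> 'a alloc \<Rightarrow> bool" where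
  "state_eq \<epsilon> \<gamma>' \<gamma> s \<longleftrightarrow> (\<forall>B \<in> budgets \<epsilon>. bids_eq \<gamma>' \<gamma> s B)"

definition state_gt :: "real \<Rightarrow> 'a profile \<Rightarrow> 'a profile \<Rightarrow> 'a alloc \<Rightarrow> bool" where
  "state_gt \<epsilon> \<gamma>' \<gamma> s \<longleftrightarrow>
     (\<forall>B \<in> budgets \<epsilon>. bids_gt \<gamma>' \<gamma> s B \<or> bids_eq \<gamma>' \<gamma> s B) \<and>
     (\<exists>B \<in> budgets \<epsilon>. bids_gt \<gamma>' \<gamma> s B)"

inductive subgame_eq :: "'a ssb \<Rightarrow> real \<Rightarrow> 'a profile \<Rightarrow> 'a profile \<Rightarrow> 'a alloc \<Rightarrow> bool"
  for F \<epsilon> \<gamma>' \<gamma> where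
  base: "s \<in> terminals F \<Longrightarrow> subgame_eq F \<epsilon> \<gamma>' \<gamma> s"
| step: "s \<in> nonterminals F \<Longrightarrow> \<forall>s' \<in> next_states F s. subgame_eq F \<epsilon> \<gamma>' \<gamma> s' \<Longrightarrow>
     state_eq \<epsilon> \<gamma>' \<gamma> s \<Longrightarrow> subgame_eq F \<epsilon> \<gamma>' \<gamma> s"

inductive subgame_gt :: "'a ssb \<Rightarrow> real \<Rightarrow> 'a profile \<Rightarrow> 'a profile \<Rightarrow> 'a alloc \<Rightarrow> bool"
  for F \<epsilon> \<gamma>' \<gamma> where
  step: "s \<in> nonterminals F \<Longrightarrow>
     \<forall>s' \<in> next_states F s. subgame_gt F \<epsilon> \<gamma>' \<gamma> s' \<or> subgame_eq F \<epsilon> \<gamma>' \<gamma> s' \<Longrightarrow>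
     (\<exists>s' \<in> next_states F s. subgame_gt F \<epsilon> \<gamma>' \<gamma> s') \<or> state_gt \<epsilon> \<gamma>' \<gamma> s \<Longrightarrow>
     subgame_gt F \<epsilon> \<gamma>' \<gamma> s"

definition pi_ge :: "'a ssb \<Rightarrow> real \<Rightarrow> 'a profile \<Rightarrow> 'a profile \<Rightarrow> bool" where
  "pi_ge F \<epsilon> \<gamma>' \<gamma> \<longleftrightarrow>
     subgame_gt F \<epsilon> \<gamma>' \<gamma> init_state \<or> subgame_eq F \<epsilon> \<gamma>' \<gamma> init_state"

definition bottom_equilibrium :: "'a ssb \<Rightarrow> real \<Rightarrow> 'a profile \<Rightarrow> bool" where
  "bottom_equilibrium F \<epsilon> \<gamma> \<longleftrightarrow> pspe F \<epsilon> \<gamma> \<and> (\<forall>\<gamma>'. pspe F \<epsilon> \<gamma>' \<longrightarrow> pi_ge F \<epsilon> \<gamma>' \<gamma>)"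

section \<open>Properties of outcome maps\<close>

definition monotone_map :: "'a ssb \<Rightarrow> real \<Rightarrow> (real \<Rightarrow> 'a alloc) \<Rightarrow> bool" where
  "monotone_map F \<epsilon> m \<longleftrightarrow>
     (\<forall>B \<in> budgets \<epsilon>. \<forall>B' \<in> budgets \<epsilon>. B' > B \<longrightarrow>
        weakly_prefers F Ag1 (m B') (m B) \<and> weakly_prefers F Ag2 (m B) (m B'))"

text \<open>Allocations with the same pair of utilities are the same outcome, so surjectivity is
  understood up to \<^const>\<open>same_outcome\<close>.\<close>

definition surjective_map :: "'a ssb \<Rightarrow> real \<Rightarrow> (real \<Rightarrow> 'a alloc) \<Rightarrow> 'a alloc set \<Rightarrow> bool" where
  "surjective_map F \<epsilon> m T \<longleftrightarrow>
     (\<forall>B \<in> budgets \<epsilon>. m B \<in> T) \<and>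
     (\<forall>t \<in> T. \<exists>B \<in> budgets \<epsilon>. same_outcome F (m B) t)"

end

theory Submission
  imports Defs
begin

text \<open>The values of the states are computed backwards, maintaining that the outcome as a function of
  the budget is monotone, has exactly the Pareto frontier of the reachable allocations as its range,
  and jumps only at multiples of \<open>R * 2 ^ (k - n)\<close> units if \<open>n\<close> items are left.

  A turn is played like an ascending auction that ends as soon as the agent whose turn it is does not
  want to raise, or cannot. The bids at that point form an equilibrium, every equilibrium has a maximal
  bid at least as high, and thus one gets the least equilibrium bids. For two neighbours on the Pareto
  frontier of the union of the two children's frontiers, agent 1 insists on the upper one as long as
  her bid leaves her with something better than the lower one, and agent 2 insists on the lower one as
  long as her bid brings her something better than the upper one. The one who can bid longer wins the
  cut. Hence the threshold between the neighbours is the mean of the two budgets at which these threats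
  end; this halves the step width, and gives pairwise different thresholds.\<close>

section \<open>Pareto frontiers and thresholds\<close>

text \<open>The stopping bid of a turn is never computed. Instead, a frontier point \<open>p\<close>
  whose lower cut is won by agent 1 and whose upper cut is won by agent 2 is shown to be the
  outcome: otherwise both agents would have given \<open>p\<close> up while still raising. The
  obstacle is that an agent's options can jump over \<open>p\<close> from one unit to the next; then
  the other child keeps the opponent from having given up \<open>p\<close> as long as her own threat
  lasts. Bids below the stopping point are no equilibrium because the loser gains by matching the
  winning bid (agent 1) or by overbidding it by one unit (agent 2). The thresholds of consecutive
  cuts differ because the two budgets of each agent coincide or are at least 2 apart, and do not
  coincide for both agents: at a budget where one child yields \<open>p\<close>, the other child
  would then be better than \<open>p\<close> for both. Budgets at which a threat never changes are
  coded as \<open>Suc M\<close>, and jumps at the full budget \<open>M\<close> are excluded, so that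
  the distance 2 holds there as well.\<close>

definition pareto_set :: "(nat \<Rightarrow> nat) \<Rightarrow> nat set \<Rightarrow> nat set" where
  "pareto_set \<rho> S = {p \<in> S. \<forall>q\<in>S. p < q \<longrightarrow> \<rho> q < \<rho> p}"

lemma pareto_set_subset: "pareto_set \<rho> S \<subseteq> S"
  by (auto simp: pareto_set_def)

lemma pareto_setD: "p \<in> pareto_set \<rho> S \<Longrightarrow> q \<in> S \<Longrightarrow> p < q \<Longrightarrow> \<rho> q < \<rho> p"
  by (auto simp: pareto_set_def)

text \<open>The largest element that is at least as good as \<open>r\<close> for both agents is
  undominated, since whatever dominates it would be a larger element of the same kind.\<close>

lemma pareto_set_dominates:
  assumes "finite S" "r \<in> S"
  obtains p where "p \<in> pareto_set \<rho> S" "r \<le> p" "\<rho> r \<le> \<rho> p"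
proof -
  let ?A = "{q \<in> S. r \<le> q \<and> \<rho> r \<le> \<rho> q}"
  have fin: "finite ?A" and ne: "?A \<noteq> {}"
    using assms by auto
  have mem: "Max ?A \<in> ?A"
    using Max_in[OF fin ne] .
  have "\<rho> q < \<rho> (Max ?A)" if "q \<in> S" "Max ?A < q" for q
  proof (rule ccontr)
    assume "\<not> \<rho> q < \<rho> (Max ?A)"
    with that mem have "q \<in> ?A"
      by auto
    then show False
      using Max_ge[OF fin] that(2) by (meson not_less)
  qed
  with mem have "Max ?A \<in> pareto_set \<rho> S"
    by (auto simp: pareto_set_def)
  with mem that show thesis
    by auto
qed

lemma pareto_set_Un:
  assumes "finite S" "finite S'" "inj_on \<rho> (S \<union> S')"
  shows "pareto_set \<rho> (pareto_set \<rho> S \<union> pareto_set \<rho> S') = pareto_set \<rho> (S \<union> S')"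
proof (intro equalityI subsetI)
  fix p assume p: "p \<in> pareto_set \<rho> (pareto_set \<rho> S \<union> pareto_set \<rho> S')"
  have "\<rho> q < \<rho> p" if "q \<in> S \<union> S'" "p < q" for q
  proof -
    have "\<exists>r \<in> pareto_set \<rho> S \<union> pareto_set \<rho> S'. q \<le> r \<and> \<rho> q \<le> \<rho> r"
      using that(1)
    proof
      assume "q \<in> S"
      from pareto_set_dominates[OF assms(1) this, of \<rho>] show ?thesis
        by blast
    next
      assume "q \<in> S'"
      from pareto_set_dominates[OF assms(2) this, of \<rho>] show ?thesis
        by blast
    qed
    then obtain r where "r \<in> pareto_set \<rho> S \<union> pareto_set \<rho> S'" "q \<le> r" "\<rho> q \<le> \<rho> r"
      by blast
    with p that(2) show ?thesis
      by (meson le_less_trans less_le_trans pareto_setD)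
  qed
  with p show "p \<in> pareto_set \<rho> (S \<union> S')"
    by (auto simp: pareto_set_def)
next
  fix p assume p: "p \<in> pareto_set \<rho> (S \<union> S')"
  then have "p \<in> pareto_set \<rho> S \<union> pareto_set \<rho> S'"
    by (auto simp: pareto_set_def)
  with p show "p \<in> pareto_set \<rho> (pareto_set \<rho> S \<union> pareto_set \<rho> S')"
    by (auto simp: pareto_set_def)
qed

text \<open>\<open>Suc M\<close> stands for a property that holds at no budget; lying just outside
  the range, it keeps \<open>threshold M Q \<le> B\<close> correct for all
  \<open>B \<le> M\<close>.\<close>

definition threshold :: "nat \<Rightarrow> (nat \<Rightarrow> bool) \<Rightarrow> nat" where
  "threshold M Q = (LEAST B. Q B \<or> B = Suc M)"

lemma threshold_le: "threshold M Q \<le> Suc M"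
  unfolding threshold_def by (rule Least_le) simp

lemma threshold_leI: "Q B \<Longrightarrow> threshold M Q \<le> B"
  unfolding threshold_def by (rule Least_le) simp

lemma threshold_holds: "threshold M Q \<le> M \<Longrightarrow> Q (threshold M Q)"
  unfolding threshold_def
  using LeastI[of "\<lambda>B. Q B \<or> B = Suc M" "Suc M"] by auto

lemma threshold_iff:
  assumes "\<And>i j. i \<le> j \<Longrightarrow> j \<le> M \<Longrightarrow> Q i \<Longrightarrow> Q j" "B \<le> M"
  shows "Q B \<longleftrightarrow> threshold M Q \<le> B"
  using assms threshold_leI[of Q B M] threshold_holds[of M Q] by (meson le_trans)

lemma threshold_mono:
  assumes "\<And>B. B \<le> M \<Longrightarrow> Q B \<Longrightarrow> Q' B"
  shows "threshold M Q' \<le> threshold M Q"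
proof (cases "threshold M Q \<le> M")
  case True
  with assms show ?thesis
    by (blast intro: threshold_leI threshold_holds)
next
  case False
  with threshold_le[of M Q'] show ?thesis
    by linarith
qed

section \<open>One turn as an ascending auction\<close>

text \<open>The functions \<open>c\<close> and \<open>d\<close> are the values of the two successor states, with budgets and bids
  measured in units of \<open>\<epsilon>\<close>, of which there are \<open>M\<close>. An outcome is coded by its rank \<open>x\<close> in the preference of agent 1, and \<open>\<rho> x\<close> is its rank for agent 2.
  Budgets are those of agent 1, so that \<open>hi c d (j - b)\<close> and \<open>lo \<rho> c d (j + b)\<close> result if agent 1,
  respectively agent 2, wins with the bid \<open>b\<close> and moves optimally.\<close>

definition hi :: "(nat \<Rightarrow> nat) \<Rightarrow> (nat \<Rightarrow> nat) \<Rightarrow> nat \<Rightarrow> nat" where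
  "hi c d B = max (c B) (d B)"

definition lo :: "(nat \<Rightarrow> nat) \<Rightarrow> (nat \<Rightarrow> nat) \<Rightarrow> (nat \<Rightarrow> nat) \<Rightarrow> nat \<Rightarrow> nat" where
  "lo \<rho> c d B = (if \<rho> (d B) \<le> \<rho> (c B) then c B else d B)"

lemma hi_ge: "c B \<le> hi c d B" "d B \<le> hi c d B"
  by (auto simp: hi_def)

lemma lo_ge: "\<rho> (c B) \<le> \<rho> (lo \<rho> c d B)" "\<rho> (d B) \<le> \<rho> (lo \<rho> c d B)"
  by (auto simp: lo_def)

lemma hi_cases: "hi c d B = c B \<or> hi c d B = d B"
  by (auto simp: hi_def)

lemma lo_cases: "lo \<rho> c d B = c B \<or> lo \<rho> c d B = d B"
  by (auto simp: lo_def)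

text \<open>The offers are raised in the order: agent 1 bids 0, agent 2 bids 1, agent 1 matches 1, agent 2
  bids 2, and so on. \<open>stop1\<close> says that agent 2 cannot or does not want to overbid \<open>b\<close>, \<open>stop2\<close> that
  agent 1 cannot or does not want to match \<open>b\<close>.\<close>

definition stop1 :: "nat \<Rightarrow> (nat \<Rightarrow> nat) \<Rightarrow> (nat \<Rightarrow> nat) \<Rightarrow> (nat \<Rightarrow> nat) \<Rightarrow> nat \<Rightarrow> nat \<Rightarrow> bool" where
  "stop1 M \<rho> c d j b \<longleftrightarrow>
     b \<le> j \<and> (Suc (j + b) \<le> M \<longrightarrow> \<rho> (lo \<rho> c d (Suc (j + b))) \<le> \<rho> (hi c d (j - b)))"

definition stop2 :: "nat \<Rightarrow> (nat \<Rightarrow> nat) \<Rightarrow> (nat \<Rightarrow> nat) \<Rightarrow> (nat \<Rightarrow> nat) \<Rightarrow> nat \<Rightarrow> nat \<Rightarrow> bool" where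
  "stop2 M \<rho> c d j b \<longleftrightarrow>
     0 < b \<and> j + b \<le> M \<and> (b \<le> j \<longrightarrow> hi c d (j - b) \<le> lo \<rho> c d (j + b))"

definition level :: "nat \<Rightarrow> (nat \<Rightarrow> nat) \<Rightarrow> (nat \<Rightarrow> nat) \<Rightarrow> (nat \<Rightarrow> nat) \<Rightarrow> nat \<Rightarrow> nat" where
  "level M \<rho> c d j = (LEAST b. stop2 M \<rho> c d j b \<or> stop1 M \<rho> c d j b)"

text \<open>The order on bids puts \<open>(m, m)\<close> below \<open>(m - 1, m)\<close>, so agent 2 wins only if \<open>(m, m)\<close> leads to a
  different outcome.\<close>

definition bid2_wins :: "nat \<Rightarrow> (nat \<Rightarrow> nat) \<Rightarrow> (nat \<Rightarrow> nat) \<Rightarrow> (nat \<Rightarrow> nat) \<Rightarrow> nat \<Rightarrow> bool" where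
  "bid2_wins M \<rho> c d j \<longleftrightarrow> (let m = level M \<rho> c d j in
     stop2 M \<rho> c d j m \<and> \<not> (m \<le> j \<and> hi c d (j - m) = lo \<rho> c d (j + m)))"

text \<open>Agent 2 bids \<open>level\<close> in either case, so only agent 1 needs a function. When
  she loses, she bids as high as possible, because the order on profiles puts higher losing bids
  lower.\<close>

definition stage_bid1 :: "nat \<Rightarrow> (nat \<Rightarrow> nat) \<Rightarrow> (nat \<Rightarrow> nat) \<Rightarrow> (nat \<Rightarrow> nat) \<Rightarrow> nat \<Rightarrow> nat" where
  "stage_bid1 M \<rho> c d j =
     (if bid2_wins M \<rho> c d j then level M \<rho> c d j - 1 else level M \<rho> c d j)"

definition stage_value :: "nat \<Rightarrow> (nat \<Rightarrow> nat) \<Rightarrow> (nat \<Rightarrow> nat) \<Rightarrow> (nat \<Rightarrow> nat) \<Rightarrow> nat \<Rightarrow> nat" where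
  "stage_value M \<rho> c d j =
     (if bid2_wins M \<rho> c d j then lo \<rho> c d (j + level M \<rho> c d j)
      else hi c d (j - level M \<rho> c d j))"

text \<open>The clause \<open>Suc j < M\<close> forbids a jump at the full budget. It keeps genuine
  thresholds at distance at least 2 from the default \<open>Suc M\<close>, and it leaves room for
  one more bid after a jump.\<close>

definition stepped :: "nat \<Rightarrow> nat \<Rightarrow> (nat \<Rightarrow> nat) \<Rightarrow> (nat \<Rightarrow> nat) \<Rightarrow> bool" where
  "stepped M G \<rho> c \<longleftrightarrow>
     (\<forall>i j. i \<le> j \<longrightarrow> j \<le> M \<longrightarrow> c i \<le> c j \<and> \<rho> (c j) \<le> \<rho> (c i)) \<and>
     (\<forall>j<M. c j \<noteq> c (Suc j) \<longrightarrow> G dvd Suc j \<and> Suc j < M)"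

lemma steppedD:
  assumes "stepped M G \<rho> c"
  shows "i \<le> j \<Longrightarrow> j \<le> M \<Longrightarrow> c i \<le> c j" "i \<le> j \<Longrightarrow> j \<le> M \<Longrightarrow> \<rho> (c j) \<le> \<rho> (c i)"
    "j < M \<Longrightarrow> c j \<noteq> c (Suc j) \<Longrightarrow> G dvd Suc j" "j < M \<Longrightarrow> c j \<noteq> c (Suc j) \<Longrightarrow> Suc j < M"
  using assms by (auto simp: stepped_def)

locale stage =
  fixes M G :: nat and \<rho> c d :: "nat \<Rightarrow> nat"
  assumes M_pos: "0 < M" and even_G: "even G" and G_dvd_M: "G dvd M"
    and c_stepped: "stepped M G \<rho> c" and d_stepped: "stepped M G \<rho> d"
    and inj_rho: "inj_on \<rho> (c ` {..M} \<union> d ` {..M})"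
begin

abbreviation T :: "nat set" where "T \<equiv> c ` {..M} \<union> d ` {..M}"
abbreviation P :: "nat set" where "P \<equiv> pareto_set \<rho> T"
abbreviation h :: "nat \<Rightarrow> nat" where "h \<equiv> hi c d"
abbreviation l :: "nat \<Rightarrow> nat" where "l \<equiv> lo \<rho> c d"

text \<open>A frontier point may come from either child; by symmetry the proofs may take it from
  \<open>c\<close>. The tie-breaking in \<open>lo\<close> is harmless, as injectivity of
  \<open>\<rho>\<close> makes such ties equalities.\<close>

lemma swap: "stage M G \<rho> d c"
  by (rule stage.intro)
    (use M_pos even_G G_dvd_M c_stepped d_stepped inj_rho in \<open>simp_all add: Un_commute\<close>)

lemma rho_eq: "x \<in> T \<Longrightarrow> y \<in> T \<Longrightarrow> \<rho> x = \<rho> y \<Longrightarrow> x = y"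
  using inj_rho by (auto dest: inj_onD)

lemma in_T: "B \<le> M \<Longrightarrow> c B \<in> T" "B \<le> M \<Longrightarrow> d B \<in> T"
    "B \<le> M \<Longrightarrow> h B \<in> T" "B \<le> M \<Longrightarrow> l B \<in> T"
  by (auto simp: hi_def lo_def max_def)

lemma hi_swap: "hi d c = h"
  by (auto simp: hi_def)

lemma lo_swap: "B \<le> M \<Longrightarrow> lo \<rho> d c B = l B"
  using rho_eq[of "c B" "d B"] in_T[of B] by (auto simp: lo_def)

lemma h_mono: "i \<le> j \<Longrightarrow> j \<le> M \<Longrightarrow> h i \<le> h j"
  using steppedD(1)[OF c_stepped, of i j] steppedD(1)[OF d_stepped, of i j]
  by (auto simp: hi_def)

lemma l_mono: "i \<le> j \<Longrightarrow> j \<le> M \<Longrightarrow> \<rho> (l j) \<le> \<rho> (l i)"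
  using steppedD(2)[OF c_stepped, of i j] steppedD(2)[OF d_stepped, of i j]
  by (auto simp: lo_def)

lemma hl_jump:
  assumes "j < M" "h j \<noteq> h (Suc j) \<or> l j \<noteq> l (Suc j)"
  shows "G dvd Suc j" "Suc j < M"
proof -
  from assms(2) have "c j \<noteq> c (Suc j) \<or> d j \<noteq> d (Suc j)"
    unfolding hi_def lo_def by metis
  with assms(1) c_stepped d_stepped show "G dvd Suc j" "Suc j < M"
    by (auto simp: stepped_def)
qed

text \<open>If \<open>p'\<close> and \<open>p''\<close> are the neighbours of \<open>p\<close> on the Pareto frontier, then \<open>low p q\<close> means that agent 1
  does not prefer \<open>q\<close> to the lower neighbour \<open>p'\<close>, and \<open>high p q\<close> that agent 2 does not prefer \<open>q\<close> to the
  upper neighbour \<open>p''\<close>. This formulation also covers the two ends of the frontier.\<close>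

definition low :: "nat \<Rightarrow> nat \<Rightarrow> bool" where
  "low p q \<longleftrightarrow> (\<exists>r\<in>T. \<rho> p < \<rho> r \<and> q \<le> r)"

definition high :: "nat \<Rightarrow> nat \<Rightarrow> bool" where
  "high p q \<longleftrightarrow> (\<exists>r\<in>T. p < r \<and> \<rho> q \<le> \<rho> r)"

text \<open>Injectivity of \<open>\<rho>\<close> excludes ties with \<open>p\<close>. The last two
  clauses say that an element between \<open>p\<close> and a neighbour in one agent's order is worse
  than \<open>p\<close> for both agents.\<close>

lemma P_cmp:
  assumes "p \<in> P" "q \<in> T"
  shows "p < q \<Longrightarrow> \<rho> q < \<rho> p" "\<rho> p < \<rho> q \<Longrightarrow> q < p"
    "p \<le> q \<Longrightarrow> \<rho> q \<le> \<rho> p" "\<rho> p \<le> \<rho> q \<Longrightarrow> q \<le> p"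
    "p \<le> q \<Longrightarrow> \<not> low p q" "\<rho> p \<le> \<rho> q \<Longrightarrow> \<not> high p q"
    "q \<noteq> p \<Longrightarrow> \<rho> q \<noteq> \<rho> p"
    "q < p \<Longrightarrow> \<not> low p q \<Longrightarrow> \<rho> q < \<rho> p"
    "\<rho> q < \<rho> p \<Longrightarrow> \<not> high p q \<Longrightarrow> q < p"
proof -
  have pT: "p \<in> T"
    using assms pareto_set_subset by auto
  show ne: "\<rho> q \<noteq> \<rho> p" if "q \<noteq> p"
    using that rho_eq[OF assms(2) pT] by auto
  show lt: "\<rho> q < \<rho> p" if "p < q"
    using pareto_setD[OF assms that] .
  show gt: "q < p" if "\<rho> p < \<rho> q"
    using that lt by (metis less_imp_not_less nat_neq_iff)
  show "\<rho> q \<le> \<rho> p" if "p \<le> q"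
    using that gt by (meson not_less)
  show "q \<le> p" if "\<rho> p \<le> \<rho> q"
    using that lt by (meson not_less)
  show "\<not> low p q" if "p \<le> q"
  proof
    assume "low p q"
    then obtain r where "r \<in> T" "\<rho> p < \<rho> r" "q \<le> r"
      by (auto simp: low_def)
    with that show False
      using pareto_setD[OF assms(1), of r] by (cases "p = r") auto
  qed
  show "\<not> high p q" if "\<rho> p \<le> \<rho> q"
  proof
    assume "high p q"
    then obtain r where "r \<in> T" "p < r" "\<rho> q \<le> \<rho> r"
      by (auto simp: high_def)
    with that show False
      using pareto_setD[OF assms(1), of r] by auto
  qed
  show "\<rho> q < \<rho> p" if "q < p" "\<not> low p q"
    using that ne assms(2) unfolding low_def by (metis le_refl nat_neq_iff)
  show "q < p" if "\<rho> q < \<rho> p" "\<not> high p q"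
    using that assms(2) unfolding high_def by (metis le_refl nat_neq_iff)
qed

lemma P_attained:
  assumes "p \<in> P"
  obtains B where "B \<le> M" "c B = p \<or> d B = p"
proof -
  from assms have "p \<in> T"
    using pareto_set_subset by blast
  then show thesis
    using that by auto
qed


lemma P_in_T: "p \<in> P \<Longrightarrow> p \<in> T"
  using pareto_set_subset by auto

text \<open>If agent 2's options jump over \<open>p\<close>, then the child that does not contain \<open>p\<close> is at least as good as \<open>p\<close>
  for agent 2 wherever \<open>p\<close> occurs, so agent 1 has no threat strictly between \<open>p\<close> and its lower neighbour.\<close>

lemma child_low_jump:
  assumes p: "p \<in> P" "B0 \<le> M" "c B0 = p"
    and B: "B \<le> M" "\<rho> p < \<rho> (l B)" "B = M \<or> \<rho> (l (Suc B)) < \<rho> p"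
    and B': "B' \<le> M" "\<not> low p (h B')"
  shows "p \<le> h B'"
proof (cases "B0 \<le> B'")
  case True
  then have "p \<le> c B'"
    using steppedD(1)[OF c_stepped, of B0 B'] p B' by simp
  then show ?thesis
    using hi_ge(1)[of c B' d] by linarith
next
  case False
  have "B0 \<le> B"
  proof (rule ccontr)
    assume "\<not> B0 \<le> B"
    then have "\<rho> (l B0) \<le> \<rho> (l (Suc B))" "B \<noteq> M"
      using l_mono[of "Suc B" B0] p by auto
    with lo_ge(1)[of \<rho> c B0 d] p B show False
      by simp
  qed
  then have "\<rho> (c B) \<le> \<rho> p"
    using steppedD(2)[OF c_stepped, of B0 B] p B by simp
  then have "\<rho> p < \<rho> (d B)"
    using B(2) lo_cases[of \<rho> c d B] by auto
  then have "\<rho> p < \<rho> (d B')"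
    using steppedD(2)[OF d_stepped, of B' B] B False \<open>B0 \<le> B\<close> by simp
  moreover have "\<rho> p \<le> \<rho> (c B')"
    using steppedD(2)[OF c_stepped, of B' B0] p False by simp
  moreover have "\<rho> (c B') \<noteq> \<rho> p" if "h B' \<noteq> p" "h B' = c B'"
    using P_cmp(7)[OF p(1) in_T(1)[OF B'(1)]] that by simp
  ultimately have "\<rho> p < \<rho> (h B')" if "h B' \<noteq> p"
    using hi_cases[of c d B'] that by (elim disjE) simp_all
  moreover have "\<not> \<rho> p < \<rho> (h B')"
    using B'(2) in_T(3)[OF B'(1)] unfolding low_def by (meson le_refl)
  ultimately show ?thesis
    by (cases "h B' = p") simp_all
qed

text \<open>Mirror image for a jump of agent 1's options: beyond \<open>B0\<close> both children are
  at least \<open>p\<close> for agent 1, so an option that still beats the upper neighbour for agent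
  2 must be \<open>p\<close> itself.\<close>

lemma child_high_jump:
  assumes p: "p \<in> P" "B0 \<le> M" "c B0 = p"
    and B: "B \<le> M" "p < h B" "B = 0 \<or> h (B - 1) < p"
    and B': "B' \<le> M" "\<not> high p (l B')"
  shows "\<rho> p \<le> \<rho> (l B')"
proof (cases "B' \<le> B0")
  case True
  then have "\<rho> p \<le> \<rho> (c B')"
    using steppedD(2)[OF c_stepped, of B' B0] p by simp
  then show ?thesis
    using lo_ge(1)[of \<rho> c B' d] by linarith
next
  case False
  have "B \<le> B0"
  proof (rule ccontr)
    assume "\<not> B \<le> B0"
    then have "h B0 \<le> h (B - 1)" "B \<noteq> 0"
      using h_mono[of B0 "B - 1"] B by auto
    with hi_ge(1)[of c B0 d] p B show False
      by simp
  qed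
  then have "c B \<le> p"
    using steppedD(1)[OF c_stepped, of B B0] p by simp
  then have "p < d B"
    using B(2) hi_cases[of c d B] by auto
  then have "p < d B'"
    using steppedD(1)[OF d_stepped, of B B'] B' False \<open>B \<le> B0\<close> by simp
  moreover have "p \<le> c B'"
    using steppedD(1)[OF c_stepped, of B0 B'] p False B' by simp
  ultimately have "p \<le> l B'"
    using lo_cases[of \<rho> c d B'] by (elim disjE) simp_all
  moreover have "\<not> p < l B'"
    using B'(2) in_T(4)[OF B'(1)] unfolding high_def by (meson le_refl)
  ultimately show ?thesis
    by (cases "l B' = p") simp_all
qed

lemma low_swap: "stage.low M \<rho> d c = low"
  using stage.low_def[OF swap] by (simp add: fun_eq_iff low_def Un_commute)

lemma high_swap: "stage.high M \<rho> d c = high"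
  using stage.high_def[OF swap] by (simp add: fun_eq_iff high_def Un_commute)

lemma low_jump:
  assumes p: "p \<in> P"
    and B: "B \<le> M" "\<rho> p < \<rho> (l B)" "B = M \<or> \<rho> (l (Suc B)) < \<rho> p"
    and B': "B' \<le> M" "\<not> low p (h B')"
  shows "p \<le> h B'"
proof -
  obtain B0 where B0: "B0 \<le> M" "c B0 = p \<or> d B0 = p"
    using P_attained[OF p] .
  from B0(2) show ?thesis
  proof
    assume "c B0 = p"
    from child_low_jump[OF p B0(1) this assms(2-)] show ?thesis .
  next
    assume "d B0 = p"
    from stage.child_low_jump[OF swap _ B0(1) this, of B B'] show ?thesis
      using assms lo_swap[of "Suc B"] by (cases "B = M") (simp_all add: Un_commute hi_swap lo_swap low_swap)
  qed
qed

lemma high_jump: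
  assumes p: "p \<in> P"
    and B: "B \<le> M" "p < h B" "B = 0 \<or> h (B - 1) < p"
    and B': "B' \<le> M" "\<not> high p (l B')"
  shows "\<rho> p \<le> \<rho> (l B')"
proof -
  obtain B0 where B0: "B0 \<le> M" "c B0 = p \<or> d B0 = p"
    using P_attained[OF p] .
  from B0(2) show ?thesis
  proof
    assume "c B0 = p"
    from child_high_jump[OF p B0(1) this assms(2-)] show ?thesis .
  next
    assume "d B0 = p"
    from stage.child_high_jump[OF swap _ B0(1) this, of B B'] show ?thesis
      using assms by (simp add: Un_commute hi_swap lo_swap high_swap)
  qed
qed

text \<open>The child that yields \<open>p\<close> does so only at a larger budget of agent 1; at
  \<open>B\<close> its value differs from \<open>p\<close> and is hence strictly better for agent
  2.\<close>

lemma P_below: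
  assumes "p \<in> P" "B \<le> M" "h B < p"
  shows "\<rho> p < \<rho> (l B)" and "B < M" and "\<rho> p \<le> \<rho> (l (Suc B))"
proof -
  obtain B0 where B0: "B0 \<le> M" "c B0 = p \<or> d B0 = p"
    using P_attained[OF assms(1)] .
  have "B < B0"
  proof (rule ccontr)
    assume "\<not> B < B0"
    then have "h B0 \<le> h B"
      using h_mono[of B0 B] assms by simp
    with assms B0 hi_ge[of c B0 d] hi_ge[of d B0 c] show False
      by auto
  qed
  then show "B < M"
    using B0 by simp
  have lB0: "\<rho> p \<le> \<rho> (l B0)"
    using lo_ge[of \<rho> c B0 d] lo_ge[of \<rho> d B0 c] B0 by auto
  with \<open>B < B0\<close> show "\<rho> p \<le> \<rho> (l (Suc B))"
    using l_mono[of "Suc B" B0] B0 by simp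
  have "\<rho> p \<le> \<rho> (c B) \<or> \<rho> p \<le> \<rho> (d B)"
    using B0 steppedD(2)[OF c_stepped, of B B0] steppedD(2)[OF d_stepped, of B B0] \<open>B < B0\<close>
    by auto
  moreover have "c B \<noteq> p" "d B \<noteq> p"
    using assms hi_ge[of c B d] hi_ge[of d B c] by auto
  ultimately have "\<rho> p < \<rho> (c B) \<or> \<rho> p < \<rho> (d B)"
    using P_cmp(7)[OF assms(1)] in_T[OF assms(2)] by (metis le_neq_implies_less)
  then show "\<rho> p < \<rho> (l B)"
    using lo_ge[of \<rho> c B d] lo_ge[of \<rho> d B c] by auto
qed

section \<open>The stopping point of the auction and the outcome there\<close>

abbreviation S1 :: "nat \<Rightarrow> nat \<Rightarrow> bool" where "S1 \<equiv> stop1 M \<rho> c d"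
abbreviation S2 :: "nat \<Rightarrow> nat \<Rightarrow> bool" where "S2 \<equiv> stop2 M \<rho> c d"
abbreviation m :: "nat \<Rightarrow> nat" where "m \<equiv> level M \<rho> c d"

lemma level_stops: "j \<le> M \<Longrightarrow> S2 j (m j) \<or> S1 j (m j)"
proof -
  assume "j \<le> M"
  \<comment> \<open>At the bid \<open>j\<close> agent 1 has spent everything: either agent 2 cannot
    overbid it, or agent 1 cannot match \<open>Suc j\<close>.\<close>
  then have "S1 j j \<or> S2 j (Suc j)"
    by (auto simp: stop1_def stop2_def)
  then show ?thesis
    unfolding level_def by (rule disjE) (rule LeastI, blast)+
qed

lemma below_level:
  assumes "b < m j"
  shows "\<not> S1 j b" "\<not> S2 j b"
  using assms not_less_Least[of b "\<lambda>b. S2 j b \<or> S1 j b"] by (auto simp: level_def)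

lemma below_level_le:
  assumes "j \<le> M" "b < m j"
  shows "b \<le> j" "Suc (j + b) \<le> M" "\<rho> (h (j - b)) < \<rho> (l (Suc (j + b)))"
proof -
  have *: "b \<le> j \<Longrightarrow> Suc (j + b) \<le> M \<and> \<rho> (h (j - b)) < \<rho> (l (Suc (j + b)))" if "b < m j" for b
    using below_level(1)[OF that] by (auto simp: stop1_def)
  \<comment> \<open>Agent 2 can pay \<open>Suc b\<close>; if agent 1 could not match it, the auction
    would have stopped there.\<close>
  show "b \<le> j"
    using assms(2)
  proof (induction b)
    case (Suc b)
    then have "Suc (j + b) \<le> M"
      using *[of b] by simp
    with below_level(2)[OF Suc.prems] show ?case
      by (auto simp: stop2_def)
  qed simp
  with * assms show "Suc (j + b) \<le> M" "\<rho> (h (j - b)) < \<rho> (l (Suc (j + b)))"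
    by auto
qed

lemma below_level_less:
  assumes "j \<le> M" "0 < b" "b < m j"
  shows "l (j + b) < h (j - b)"
  using below_level(2)[OF assms(3)] below_level_le[OF assms(1), of b] assms
  by (auto simp: stop2_def)


text \<open>\<open>D1\<close> and \<open>D2\<close> mean that an agent cannot pay the bid or falls
  below \<open>p\<close> by winning with it. Whoever gives up last still has something strictly
  better than \<open>p\<close> one bid earlier, because raising continued. So her options jump over
  \<open>p\<close> or end, and \<open>low_jump\<close> or \<open>high_jump\<close> shows that the
  other agent has not given up.\<close>

lemma not_both_give_up:
  assumes p: "p \<in> P" and j: "j \<le> M"
    and L: "\<And>b. j + b \<le> M \<Longrightarrow> \<rho> p < \<rho> (l (j + b)) \<Longrightarrow> b \<le> j \<and> \<not> low p (h (j - b))"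
    and U: "\<And>b. b \<le> j \<Longrightarrow> p < h (j - b) \<Longrightarrow> Suc (j + b) \<le> M \<and> \<not> high p (l (Suc (j + b)))"
    and raise2: "\<And>b. b < n1 \<Longrightarrow>
      b \<le> j \<and> Suc (j + b) \<le> M \<and> \<rho> (h (j - b)) < \<rho> (l (Suc (j + b)))"
    and raise1: "\<And>b. 0 < b \<Longrightarrow> b < n2 \<Longrightarrow> b \<le> j \<and> j + b \<le> M \<and> l (j + b) < h (j - b)"
    and n1: "j < n1 \<or> h (j - n1) < p"
    and n2: "0 < n2" "M < j + n2 \<or> \<rho> (l (j + n2)) < \<rho> p"
  shows False
proof -
  define D1 where "D1 = (\<lambda>b. j < b \<or> h (j - b) < p)"
  define D2 where "D2 = (\<lambda>b. 0 < b \<and> (M < j + b \<or> \<rho> (l (j + b)) < \<rho> p))"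
  define b1 where "b1 = (LEAST b. D1 b)"
  define b2 where "b2 = (LEAST b. D2 b)"
  have D: "D1 n1" "D2 n2"
    using n1 n2 by (auto simp: D1_def D2_def)
  have b1: "D1 b1" "b1 \<le> n1"
    unfolding b1_def using D(1) by (auto intro: LeastI Least_le)
  have b1_least: "\<not> D1 b" if "b < b1" for b
    using that not_less_Least unfolding b1_def by blast
  have b2: "D2 b2" "b2 \<le> n2"
    unfolding b2_def using D(2) by (auto intro: LeastI Least_le)
  have b2_least: "\<not> D2 b" if "b < b2" for b
    using that not_less_Least unfolding b2_def by blast
  have D1_mono: "D1 b" if "D1 a" "a \<le> b" for a b
    using that h_mono[of "j - b" "j - a"] j unfolding D1_def by fastforce
  show False
  proof (cases "b1 < b2")
    case True
    show False
    \<comment> \<open>The first bid of agent 2 is 1, so here she has no earlier bid to look at, and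
      \<open>P_below\<close> replaces the jump argument.\<close>
    proof (cases "b2 = 1")
      case True
      with \<open>b1 < b2\<close> have "b1 = 0"
        by simp
      with b1 have "h j < p"
        by (simp add: D1_def)
      from P_below(2,3)[OF p j this] b2 True show False
        by (auto simp: D2_def)
    next
      case False
      define b where "b = b2 - 1"
      have b: "0 < b" "Suc b = b2" "b < n2" "b1 \<le> b"
        using False b2 \<open>b1 < b2\<close> by (auto simp: b_def D2_def)
      have pass: "b \<le> j" "j + b \<le> M" "l (j + b) < h (j - b)"
        using raise1[OF b(1,3)] by auto
      have "h (j - b) < p"
        using D1_mono[OF b1(1) b(4)] pass by (simp add: D1_def)
      moreover have "\<rho> p \<le> \<rho> (l (j + b))"
        using b2_least[of b] b pass by (auto simp: D2_def)
      moreover have lT: "l (j + b) \<in> T"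
        using in_T(4) pass by blast
      ultimately have lb: "\<rho> p < \<rho> (l (j + b))"
        using pass P_cmp(7)[OF p lT] by (metis le_neq_implies_less less_asym)
      have nlow: "\<not> low p (h (j - b))"
        using L[OF pass(2) lb] by simp
      have "j + b = M \<or> \<rho> (l (Suc (j + b))) < \<rho> p"
        using b2(1) b(2) pass by (auto simp: D2_def)
      from low_jump[OF p pass(2) lb this _ nlow] \<open>h (j - b) < p\<close> j show False
        by (simp add: le_diff_conv)
    qed
  next
    case False
    define b where "b = b1 - 1"
    have b: "Suc b = b1" "b < n1" "b2 \<le> Suc b"
      using False b1 b2 by (auto simp: b_def D2_def)
    have pass: "b \<le> j" "Suc (j + b) \<le> M" "\<rho> (h (j - b)) < \<rho> (l (Suc (j + b)))"
      using raise2[OF b(2)] by auto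
    have "p \<le> h (j - b)"
      using b1_least[of b] b pass by (auto simp: D1_def)
    moreover have lp: "\<rho> (l (Suc (j + b))) < \<rho> p"
      using b2(1) b(3) l_mono[of "j + b2" "Suc (j + b)"] pass by (auto simp: D2_def)
    ultimately have hp: "p < h (j - b)"
      using pass by (metis le_neq_implies_less less_asym)
    have nhigh: "\<not> high p (l (Suc (j + b)))"
      using U[OF pass(1) hp] by simp
    have "j - b = 0 \<or> h (j - b - 1) < p"
      using b1(1) b(1) by (auto simp: D1_def)
    from high_jump[OF p _ hp this pass(2) nhigh] lp j show False
      by (simp add: le_diff_conv)
  qed
qed

text \<open>An outcome better than \<open>p\<close> for the winner is excluded by the opponent's
  threat, expressed by \<open>L\<close> and \<open>U\<close>. An outcome worse than \<open>p\<close>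
  for the winner means that she has given up, and then the opponent has given up too.\<close>

lemma level_value:
  assumes p: "p \<in> P" and j: "j \<le> M"
    and L: "\<And>b. j + b \<le> M \<Longrightarrow> \<rho> p < \<rho> (l (j + b)) \<Longrightarrow> b \<le> j \<and> \<not> low p (h (j - b))"
    and U: "\<And>b. b \<le> j \<Longrightarrow> p < h (j - b) \<Longrightarrow> Suc (j + b) \<le> M \<and> \<not> high p (l (Suc (j + b)))"
  shows "S2 j (m j) \<Longrightarrow> l (j + m j) = p" and "\<not> S2 j (m j) \<Longrightarrow> h (j - m j) = p"
proof -
  let ?m = "m j"
  have raise2: "b \<le> j \<and> Suc (j + b) \<le> M \<and> \<rho> (h (j - b)) < \<rho> (l (Suc (j + b)))" if "b < ?m" for b
    using below_level_le[OF j that] by simp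
  have raise1: "b \<le> j \<and> j + b \<le> M \<and> l (j + b) < h (j - b)" if "0 < b" "b < ?m" for b
    using below_level_less[OF j that] below_level_le[OF j that(2)] by simp
  show "l (j + ?m) = p" if S2: "S2 j ?m"
  proof (rule ccontr)
    assume neq: "l (j + ?m) \<noteq> p"
    have m: "0 < ?m" "j + ?m \<le> M" and stop: "?m \<le> j \<Longrightarrow> h (j - ?m) \<le> l (j + ?m)"
      using S2 by (auto simp: stop2_def)
    have wT: "l (j + ?m) \<in> T"
      using in_T(4) m by blast
    have "\<not> \<rho> p < \<rho> (l (j + ?m))"
      using L[OF m(2)] stop wT unfolding low_def by blast
    with P_cmp(7)[OF p wT neq] have w: "\<rho> (l (j + ?m)) < \<rho> p"
      by simp
    have "j < ?m \<or> h (j - ?m) < p"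
    proof (cases "high p (l (j + ?m))")
      case False
      with P_cmp(9)[OF p wT w] stop show ?thesis
        by fastforce
    next
      case True
      define b where "b = ?m - 1"
      have b: "b < ?m" "Suc b = ?m"
        using m by (auto simp: b_def)
      then have Sb: "Suc (j + b) = j + ?m"
        by simp
      have pass: "b \<le> j" "\<rho> (h (j - b)) < \<rho> (l (j + ?m))"
        using raise2[OF b(1)] unfolding Sb by auto
      have "\<not> p < h (j - b)"
        using U[OF pass(1)] True unfolding Sb by auto
      moreover have "h (j - b) \<noteq> p"
        using pass w by auto
      ultimately have "h (j - b) < p"
        by simp
      then show ?thesis
        using h_mono[of "j - ?m" "j - b"] b(2) j by fastforce
    qed
    from not_both_give_up[OF p j L U raise2 raise1 this m(1)] w show False
      by blast
  qed
  show "h (j - ?m) = p" if nS2: "\<not> S2 j ?m"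
  proof (rule ccontr)
    assume neq: "h (j - ?m) \<noteq> p"
    have m: "?m \<le> j"
      and stop: "Suc (j + ?m) \<le> M \<Longrightarrow> \<rho> (l (Suc (j + ?m))) \<le> \<rho> (h (j - ?m))"
      using level_stops[OF j] nS2 by (auto simp: stop1_def)
    have uT: "h (j - ?m) \<in> T"
      using in_T(3)[of "j - ?m"] j by simp
    have "\<not> p < h (j - ?m)"
      using U[OF m] stop uT unfolding high_def by blast
    with neq have u: "h (j - ?m) < p"
      by simp
    have raise1': "j + ?m \<le> M \<and> l (j + ?m) < h (j - ?m)" if pos: "0 < ?m"
    proof -
      from pos raise2[of "?m - 1"] have "j + ?m \<le> M"
        by simp
      with nS2 pos m show ?thesis
        by (auto simp: stop2_def)
    qed
    \<comment> \<open>Agent 1 made the last offer, so agent 2 gives up at her next bid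
      \<open>Suc m\<close>, not at \<open>m\<close>.\<close>
    have "M < j + Suc ?m \<or> \<rho> (l (j + Suc ?m)) < \<rho> p"
    proof (cases "low p (h (j - ?m))")
      case False
      with P_cmp(8)[OF p uT u] stop show ?thesis
        by fastforce
    next
      case True
      have "0 < ?m"
      proof (rule ccontr)
        assume "\<not> 0 < ?m"
        with True L[of 0] P_below(1)[OF p j] u j show False
          by simp
      qed
      then have w: "j + ?m \<le> M" "l (j + ?m) < h (j - ?m)"
        using raise1' by auto
      then have wT: "l (j + ?m) \<in> T"
        using in_T(4) by blast
      have "\<not> \<rho> p < \<rho> (l (j + ?m))"
        using L[OF w(1)] True by blast
      with P_cmp(7)[OF p wT] w u have "\<rho> (l (j + ?m)) < \<rho> p"
        by fastforce
      then show ?thesis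
        using l_mono[of "j + ?m" "j + Suc ?m"] by fastforce
    qed
    moreover have "b \<le> j \<and> j + b \<le> M \<and> l (j + b) < h (j - b)" if "0 < b" "b < Suc ?m" for b
      using raise1[OF that(1)] raise1' m that by (cases "b = ?m") auto
    ultimately show False
      using not_both_give_up[OF p j L U raise2, of "?m" "Suc ?m"] u by blast
  qed
qed

text \<open>Subgame perfection does not restrict the state that the loser of a turn would have chosen, so
  \<open>(m, m)\<close> could be supported by a threat of agent 2 to move to the worse child after winning. The step width of the
  children's values, which is at least 2, rules this out unless the outcome is the same.\<close>

lemma tie_at_level_aux:
  assumes j: "j \<le> M" and S2: "S2 j (m j)" and mj: "m j \<le> j"
    and weak: "d (j + m j) \<le> h (j - m j)"
    and stop: "Suc (j + m j) \<le> M \<Longrightarrow> \<rho> (l (Suc (j + m j))) \<le> \<rho> (h (j - m j))"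
    and p: "l (j + m j) = c (j + m j)"
  shows "h (j - m j) = l (j + m j)"
proof (rule ccontr)
  let ?m = "m j"
  let ?p = "c (j + ?m)"
  assume "h (j - ?m) \<noteq> l (j + ?m)"
  with S2 mj p have u: "h (j - ?m) < ?p" and m: "0 < ?m" "j + ?m \<le> M"
    by (auto simp: stop2_def)
  define b where "b = ?m - 1"
  have b: "b < ?m" "Suc b = ?m"
    using m by (auto simp: b_def)
  then have Sb: "Suc (j + b) = j + ?m"
    by simp
  have pass: "\<rho> (h (j - b)) < \<rho> ?p"
    using below_level_le(3)[OF j b(1)] unfolding Sb p .
  have cb: "h (j - ?m) \<le> h (j - b)" "c (j - b) \<le> ?p" "\<rho> ?p \<le> \<rho> (c (j - b))"
    using b m h_mono[of "j - ?m" "j - b"] steppedD(1,2)[OF c_stepped, of "j - b" "j + ?m"]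
    by auto
  have db: "d (j - b) \<le> d (j + ?m)"
    using m steppedD(1)[OF d_stepped, of "j - b" "j + ?m"] by simp
  \<comment> \<open>Monotonicity and \<open>weak\<close> squeeze \<open>d\<close>: it equals agent
    1's outcome from matching at both \<open>j - b\<close> and \<open>j + m\<close>.\<close>
  have hb: "h (j - b) = d (j - b)" "d (j - b) = h (j - ?m)" "d (j + ?m) = h (j - ?m)"
  proof -
    show *: "h (j - b) = d (j - b)"
      using pass cb(3) hi_cases[of c d "j - b"] by auto
    show "d (j - b) = h (j - ?m)" "d (j + ?m) = h (j - ?m)"
      using cb(1) db weak * by auto
  qed
  have dm: "\<rho> (d (j + ?m)) < \<rho> ?p"
    using pass hb by simp
  \<comment> \<open>If \<open>c\<close> jumped at \<open>j + m\<close>, then \<open>stop\<close>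
    would force another jump one unit later, whereas all jumps lie at even budgets.\<close>
  have "c (j + b) = c (Suc (j + b))"
  proof (rule ccontr)
    assume "c (j + b) \<noteq> c (Suc (j + b))"
    then have G1: "G dvd j + ?m" "j + ?m < M"
      using steppedD(3,4)[OF c_stepped, of "j + b"] m b(1) unfolding Sb by auto
    then have "\<rho> (l (Suc (j + ?m))) < \<rho> ?p"
      using stop dm hb by simp
    then have "c (Suc (j + ?m)) \<noteq> ?p"
      using lo_ge(1)[of \<rho> c "Suc (j + ?m)" d] by auto
    then have "G dvd Suc (j + ?m)"
      using steppedD(3)[OF c_stepped, of "j + ?m"] G1 by auto
    with G1 even_G show False
      by (metis dvd_trans even_Suc)
  qed
  then have cjb: "c (j + b) = ?p"
    unfolding Sb .
  have djb: "d (j + b) = d (j + ?m)"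
    using hb b m steppedD(1)[OF d_stepped, of "j - b" "j + b"]
      steppedD(1)[OF d_stepped, of "j + b" "j + ?m"] by simp
  have ljb: "l (j + b) = ?p"
    using cjb djb dm by (simp add: lo_def)
  show False
  proof (cases "b = 0")
    case True
    with pass cjb hb u show False
      using hi_ge(1)[of c j d] by simp
  next
    case False
    with below_level_less[OF j _ b(1)] have "?p < h (j - b)"
      using ljb by simp
    with hb u show False
      by simp
  qed
qed

lemma stop2_swap: "j \<le> M \<Longrightarrow> stop2 M \<rho> d c j b = S2 j b"
  by (auto simp: stop2_def hi_swap lo_swap)

lemma stop1_swap: "j \<le> M \<Longrightarrow> stop1 M \<rho> d c j b = S1 j b"
  by (auto simp: stop1_def hi_swap lo_swap)

lemma level_swap: "j \<le> M \<Longrightarrow> level M \<rho> d c j = m j"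
  by (simp add: level_def stop1_swap stop2_swap)

lemma tie_at_level:
  assumes j: "j \<le> M" and S2: "S2 j (m j)" and mj: "m j \<le> j"
    and weak: "c (j + m j) \<le> h (j - m j) \<or> d (j + m j) \<le> h (j - m j)"
    and stop: "Suc (j + m j) \<le> M \<Longrightarrow> \<rho> (l (Suc (j + m j))) \<le> \<rho> (h (j - m j))"
  shows "h (j - m j) = l (j + m j)"
proof (rule ccontr)
  assume neq: "h (j - m j) \<noteq> l (j + m j)"
  have m: "j + m j \<le> M" and le: "h (j - m j) \<le> l (j + m j)"
    using S2 mj by (auto simp: stop2_def)
  from lo_cases[of \<rho> c d "j + m j"] show False
  proof
    assume "l (j + m j) = c (j + m j)"
    with tie_at_level_aux[OF j S2 mj _ stop] weak le neq show False
      by auto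
  next
    assume *: "l (j + m j) = d (j + m j)"
    with weak le neq have "c (j + m j) \<le> h (j - m j)"
      by auto
    with stage.tie_at_level_aux[OF swap j] S2 mj stop * neq m show False
      by (simp add: level_swap j stop2_swap hi_swap lo_swap)
  qed
qed


text \<open>Agent 2 defends the lower cut of \<open>p\<close>, the one between \<open>p\<close> and its lower neighbour, with bids \<open>b\<close> such
  that \<open>j + b < lower2 p\<close>, and agent 1 attacks it with bids such that \<open>lower1 p \<le> j - b\<close>; likewise for the
  upper cut. So \<open>selects p j\<close> says that agent 1 wins the lower cut of \<open>p\<close> and agent 2 the upper one.\<close>

definition lower2 :: "nat \<Rightarrow> nat" where "lower2 p = threshold M (\<lambda>B. \<rho> (l B) \<le> \<rho> p)"
definition lower1 :: "nat \<Rightarrow> nat" where "lower1 p = threshold M (\<lambda>B. \<not> low p (h B))"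
definition upper2 :: "nat \<Rightarrow> nat" where "upper2 p = threshold M (\<lambda>B. high p (l B))"
definition upper1 :: "nat \<Rightarrow> nat" where "upper1 p = threshold M (\<lambda>B. p < h B)"

definition selects :: "nat \<Rightarrow> nat \<Rightarrow> bool" where
  "selects p j \<longleftrightarrow> p \<in> P \<and> lower2 p + lower1 p \<le> 2 * j + 1 \<and> 2 * j + 2 \<le> upper2 p + upper1 p"

lemma low_antimono: "low p q \<Longrightarrow> q' \<le> q \<Longrightarrow> low p q'"
  unfolding low_def by (meson le_trans)

lemma high_antimono: "high p q \<Longrightarrow> \<rho> q' \<le> \<rho> q \<Longrightarrow> high p q'"
  unfolding high_def by (meson le_trans)

lemma thresholds:
  assumes "B \<le> M"
  shows "\<rho> (l B) \<le> \<rho> p \<longleftrightarrow> lower2 p \<le> B" "\<not> low p (h B) \<longleftrightarrow> lower1 p \<le> B"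
    "high p (l B) \<longleftrightarrow> upper2 p \<le> B" "p < h B \<longleftrightarrow> upper1 p \<le> B"
  unfolding lower2_def lower1_def upper2_def upper1_def
  by (rule threshold_iff[OF _ assms];
      meson h_mono l_mono low_antimono high_antimono le_trans less_le_trans)+

lemma selects_stage_value:
  assumes "j \<le> M" "selects p j"
  shows "S2 j (m j) \<Longrightarrow> l (j + m j) = p" "\<not> S2 j (m j) \<Longrightarrow> h (j - m j) = p"
    "stage_value M \<rho> c d j = p"
proof -
  have p: "p \<in> P" and s: "lower2 p + lower1 p \<le> 2 * j + 1" "2 * j + 2 \<le> upper2 p + upper1 p"
    using assms(2) by (auto simp: selects_def)
  \<comment> \<open>The last defending bid of agent 2 is \<open>lower2 p - 1 - j\<close>, the last
    attacking bid of agent 1 is \<open>j - lower1 p\<close>. Ties go to agent 1, hence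
    \<open>2 * j + 1\<close> at the lower cut but \<open>2 * j + 2\<close> at the upper one.\<close>
  have L: "b \<le> j \<and> \<not> low p (h (j - b))" if "j + b \<le> M" "\<rho> p < \<rho> (l (j + b))" for b
  proof -
    have "j + b < lower2 p"
      using thresholds(1)[OF that(1), of p] that(2) by simp
    with s have "lower1 p + b \<le> j"
      by simp
    then show ?thesis
      using thresholds(2)[of "j - b" p] assms by simp
  qed
  have U: "Suc (j + b) \<le> M \<and> \<not> high p (l (Suc (j + b)))" if "b \<le> j" "p < h (j - b)" for b
  proof -
    have "upper1 p \<le> j - b"
      using thresholds(4)[of "j - b" p] that assms by simp
    then have "Suc (j + b) < upper2 p"
      using s that by simp
    moreover have "upper2 p \<le> Suc M"
      unfolding upper2_def by (rule threshold_le)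
    ultimately show ?thesis
      using thresholds(3)[of "Suc (j + b)" p] by simp
  qed
  show *: "S2 j (m j) \<Longrightarrow> l (j + m j) = p" "\<not> S2 j (m j) \<Longrightarrow> h (j - m j) = p"
    using level_value[OF p assms(1) L U] by blast+
  then show "stage_value M \<rho> c d j = p"
    by (auto simp: stage_value_def bid2_wins_def Let_def)
qed

text \<open>Take the largest frontier point whose lower cut agent 1 wins. Its upper cut is the lower
  cut of the next frontier point, which agent 1 does not win.\<close>

lemma selects_exists:
  assumes "j \<le> M"
  obtains p where "selects p j"
proof -
  have fin: "finite T" "finite P"
    using finite_subset[OF pareto_set_subset] by auto
  have ne: "P \<noteq> {}"
    using pareto_set_dominates[OF fin(1), of "c 0" \<rho>] by auto
  define A where "A = {p \<in> P. lower2 p + lower1 p \<le> 2 * j + 1}"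
  have fA: "finite A"
    using fin by (simp add: A_def)
  have "Min P \<in> A"
  proof -
    let ?p = "Min P"
    have p: "?p \<in> P"
      using fin ne by simp
    have "\<rho> r \<le> \<rho> ?p" if "r \<in> T" for r
    proof -
      obtain q where q: "q \<in> P" "r \<le> q" "\<rho> r \<le> \<rho> q"
        using pareto_set_dominates[OF fin(1) \<open>r \<in> T\<close>] .
      then have "?p \<le> q"
        using fin by simp
      then show ?thesis
        using P_cmp(3)[OF p P_in_T[OF q(1)]] q by simp
    qed
    then have "\<rho> (l 0) \<le> \<rho> ?p" "\<not> low ?p (h 0)"
      using in_T(4)[of 0] unfolding low_def by (blast, meson not_less)
    then have "lower2 ?p = 0" "lower1 ?p = 0"
      using thresholds(1,2)[of 0 ?p] by auto
    with p show ?thesis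
      by (simp add: A_def)
  qed
  with fA have "Max A \<in> A"
    using Max_in by blast
  define p where "p = Max A"
  have p: "p \<in> P" "lower2 p + lower1 p \<le> 2 * j + 1"
    using \<open>Max A \<in> A\<close> by (auto simp: A_def p_def)
  have "2 * j + 2 \<le> upper2 p + upper1 p"
  proof (cases "\<exists>q\<in>P. p < q")
    case False
    have "r \<le> p" if r: "r \<in> T" for r
    proof -
      obtain q where "q \<in> P" "r \<le> q"
        using pareto_set_dominates[OF fin(1) \<open>r \<in> T\<close>] .
      with False show ?thesis
        by (meson le_trans not_less)
    qed
    then have "\<not> high p (l M)" "\<not> p < h M"
      using in_T(3)[of M] unfolding high_def by (meson not_less le_refl)+
    then have "\<not> upper2 p \<le> M" "\<not> upper1 p \<le> M"
      using thresholds(3,4)[of M p] by auto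
    with assms show ?thesis
      by simp
  next
    case True
    define q where "q = Min {q \<in> P. p < q}"
    have "q \<in> {q \<in> P. p < q}"
      unfolding q_def using True fin by (intro Min_in) auto
    then have q: "q \<in> P" "p < q"
      by auto
    have q_le: "q \<le> r" if "r \<in> P" "p < r" for r
      unfolding q_def using that fin by (intro Min_le) auto
    have "q \<notin> A"
      using Max_ge[OF fA, of q] q by (auto simp: p_def)
    then have "2 * j + 2 \<le> lower2 q + lower1 q"
      using q by (simp add: A_def)
    moreover have "lower2 q \<le> upper2 p"
      unfolding lower2_def upper2_def
    proof (rule threshold_mono)
      fix B assume "high p (l B)"
      then obtain r where r: "r \<in> T" "p < r" "\<rho> (l B) \<le> \<rho> r"
        by (auto simp: high_def)
      obtain s where s: "s \<in> P" "r \<le> s" "\<rho> r \<le> \<rho> s"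
        using pareto_set_dominates[OF fin(1) r(1)] .
      then have "\<rho> s \<le> \<rho> q"
        using P_cmp(3)[OF q(1) P_in_T[OF s(1)]] q_le[OF s(1)] r by simp
      with s r show "\<rho> (l B) \<le> \<rho> q"
        by simp
    qed
    moreover have "lower1 q \<le> upper1 p"
      unfolding lower1_def upper1_def
    proof (rule threshold_mono, rule notI)
      fix B assume "p < h B" "low q (h B)"
      then obtain r where r: "r \<in> T" "\<rho> q < \<rho> r" "p < r"
        unfolding low_def by (meson less_le_trans)
      obtain s where s: "s \<in> P" "r \<le> s" "\<rho> r \<le> \<rho> s"
        using pareto_set_dominates[OF fin(1) r(1)] .
      then have "\<rho> s \<le> \<rho> q"
        using P_cmp(3)[OF q(1) P_in_T[OF s(1)]] q_le[OF s(1)] r by simp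
      with s r show False
        by simp
    qed
    ultimately show ?thesis
      by simp
  qed
  with p that show thesis
    by (simp add: selects_def)
qed

text \<open>If \<open>q < p\<close>, the upper thresholds of \<open>q\<close> are at most the lower
  thresholds of \<open>p\<close>, and the two inequalities force \<open>j < i\<close>.\<close>

lemma selects_mono:
  assumes "selects p i" "selects q j" "i \<le> j" "j \<le> M"
  shows "p \<le> q"
proof (rule ccontr)
  assume "\<not> p \<le> q"
  then have qp: "q < p"
    by simp
  have p: "p \<in> P" and q: "q \<in> P"
    using assms by (auto simp: selects_def)
  have rho: "\<rho> p < \<rho> q"
    using pareto_setD[OF q P_in_T[OF p] qp] .
  have "upper2 q \<le> lower2 p"
    unfolding lower2_def upper2_def
    using P_in_T[OF p] qp by (intro threshold_mono) (auto simp: high_def)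
  moreover have "upper1 q \<le> lower1 p"
    unfolding lower1_def upper1_def
  proof (rule threshold_mono)
    fix B assume "\<not> low p (h B)"
    with P_in_T[OF q] rho show "q < h B"
      unfolding low_def by (meson not_less)
  qed
  ultimately show False
    using assms unfolding selects_def by linarith
qed

lemma stage_value_selects: "j \<le> M \<Longrightarrow> selects (stage_value M \<rho> c d j) j"
  using selects_exists selects_stage_value(3) by metis

lemma threshold_step:
  assumes "\<And>i. i < M \<Longrightarrow> Q i \<noteq> Q (Suc i) \<Longrightarrow> G dvd Suc i \<and> Suc i < M"
  shows "threshold M Q = Suc M \<or> G dvd threshold M Q \<and> threshold M Q < M"
proof (cases "threshold M Q = 0 \<or> threshold M Q = Suc M")
  case False
  then obtain i where i: "threshold M Q = Suc i" "i < M"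
    using threshold_le[of M Q] by (metis Suc_le_mono le_neq_implies_less not0_implies_Suc)
  have "Q (Suc i)"
    using threshold_holds[of M Q] i by simp
  moreover have "\<not> Q i"
    using threshold_leI[of Q i M] i by auto
  ultimately show ?thesis
    using assms[of i] i by auto
qed (use M_pos in auto)

lemma thresholds_step:
  "lower2 p = Suc M \<or> G dvd lower2 p \<and> lower2 p < M" "lower1 p = Suc M \<or> G dvd lower1 p \<and> lower1 p < M"
  "upper2 p = Suc M \<or> G dvd upper2 p \<and> upper2 p < M" "upper1 p = Suc M \<or> G dvd upper1 p \<and> upper1 p < M"
  unfolding lower2_def lower1_def upper2_def upper1_def
  by (rule threshold_step; metis hl_jump)+

lemma stage_value_onto: "stage_value M \<rho> c d ` {..M} = P"
proof (intro equalityI subsetI)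
  fix p assume p: "p \<in> P"
  obtain B where B: "B \<le> M" "c B = p \<or> d B = p"
    using P_attained[OF p] .
  have hB: "p \<le> h B" and lB: "\<rho> p \<le> \<rho> (l B)"
    using B hi_ge[of c B d] hi_ge[of d B c] lo_ge[of \<rho> c B d] lo_ge[of \<rho> d B c] by auto
  have Y: "lower1 p \<le> B"
    using thresholds(2)[OF B(1), of p] P_cmp(5)[OF p in_T(3)[OF B(1)] hB] by simp
  have X: "B < upper2 p"
    using thresholds(3)[OF B(1), of p] P_cmp(6)[OF p in_T(4)[OF B(1)] lB] by simp
  have XX: "lower2 p \<le> upper2 p"
    unfolding lower2_def upper2_def
  proof (rule threshold_mono)
    fix B assume "B \<le> M" "high p (l B)"
    with P_cmp(6)[OF p in_T(4)] show "\<rho> (l B) \<le> \<rho> p"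
      by (meson not_less less_imp_le)
  qed
  have YY: "lower1 p \<le> upper1 p"
    unfolding lower1_def upper1_def
  proof (rule threshold_mono)
    fix B assume "B \<le> M" "p < h B"
    with P_cmp(5)[OF p in_T(3)] show "\<not> low p (h B)"
      by simp
  qed
  \<comment> \<open>One child yields \<open>p\<close> at \<open>B\<close>. If all thresholds
    coincided, \<open>h B\<close> and \<open>l B\<close> would both differ from \<open>p\<close>, so
    both would come from the other child, which would dominate \<open>p\<close>.\<close>
  have ne: "lower2 p \<noteq> upper2 p \<or> lower1 p \<noteq> upper1 p"
  proof (rule ccontr)
    assume "\<not> ?thesis"
    with X Y have "\<rho> p < \<rho> (l B)" "p < h B"
      using thresholds(1,4)[OF B(1), of p] by auto
    with B have "p < c B \<and> \<rho> p < \<rho> (c B) \<or> p < d B \<and> \<rho> p < \<rho> (d B)"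
      using hi_cases[of c d B] lo_cases[of \<rho> c d B] by auto
    then show False
      using pareto_setD[OF p in_T(1)[OF B(1)]] pareto_setD[OF p in_T(2)[OF B(1)]] by auto
  qed
  \<comment> \<open>Distinct thresholds are both even, or one is \<open>Suc M\<close> and the other
    below \<open>M\<close>.\<close>
  have gap: "Suc (Suc t) \<le> t'"
    if "t \<le> t'" "t \<noteq> t'" "t = Suc M \<or> G dvd t \<and> t < M" "t' = Suc M \<or> G dvd t' \<and> t' < M" for t t'
  proof (cases "t' = Suc M")
    case False
    then have "even t" "even t'"
      using that even_G by (auto intro: dvd_trans)
    then have "Suc t \<noteq> t'"
      by auto
    with that show ?thesis
      by simp
  qed (use that in auto)
  have "lower2 p + lower1 p + 2 \<le> upper2 p + upper1 p"
    using gap[of "lower2 p" "upper2 p"] gap[of "lower1 p" "upper1 p"] thresholds_step[of p] XX YY ne by auto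
  \<comment> \<open>Half the sum rounded down is the least budget that meets the lower inequality;
    the surplus of 2 gives the upper one.\<close>
  moreover define j where "j = (lower2 p + lower1 p) div 2"
  moreover have "upper2 p \<le> Suc M" "upper1 p \<le> Suc M"
    unfolding upper2_def upper1_def by (rule threshold_le)+
  ultimately have "selects p j" "j \<le> M"
    using p by (auto simp: selects_def)
  then show "p \<in> stage_value M \<rho> c d ` {..M}"
    using selects_stage_value(3) by force
qed (use stage_value_selects in \<open>auto simp: selects_def\<close>)

lemma stage_value_mono:
  assumes "i \<le> j" "j \<le> M"
  shows "stage_value M \<rho> c d i \<le> stage_value M \<rho> c d j"
    "\<rho> (stage_value M \<rho> c d j) \<le> \<rho> (stage_value M \<rho> c d i)"
proof -
  have s: "selects (stage_value M \<rho> c d i) i" "selects (stage_value M \<rho> c d j) j"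
    using stage_value_selects assms by auto
  from selects_mono[OF this assms] show *: "stage_value M \<rho> c d i \<le> stage_value M \<rho> c d j" .
  from s have "stage_value M \<rho> c d i \<in> P" "stage_value M \<rho> c d j \<in> P"
    by (auto simp: selects_def)
  with * show "\<rho> (stage_value M \<rho> c d j) \<le> \<rho> (stage_value M \<rho> c d i)"
    using P_cmp(3) P_in_T by blast
qed

text \<open>The lower inequality of \<open>p\<close> persists at \<open>Suc j\<close>, so the upper
  one fails there. Hence \<open>Suc j\<close> is the mean of the upper thresholds of
  \<open>p\<close>, rounded down.\<close>

lemma stage_value_jump:
  assumes j: "j < M" and neq: "stage_value M \<rho> c d j \<noteq> stage_value M \<rho> c d (Suc j)"
  shows "G div 2 dvd Suc j" "Suc j < M"
proof -
  define p where "p = stage_value M \<rho> c d j"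
  have p: "selects p j" "p \<in> P"
    using stage_value_selects[of j] j by (auto simp: p_def selects_def)
  have "\<not> selects p (Suc j)"
    using selects_stage_value(3)[of "Suc j" p] j neq by (auto simp: p_def)
  with p have sum: "upper2 p + upper1 p = 2 * Suc j \<or> upper2 p + upper1 p = 2 * Suc j + 1"
    by (auto simp: selects_def)
  \<comment> \<open>If agent 1 never gets above \<open>p\<close>, nothing in \<open>T\<close> lies
    above \<open>p\<close>, so both upper thresholds are \<open>Suc M\<close>. Their mean would
    exceed every \<open>Suc j \<le> M\<close>.\<close>
  have X: "upper2 p = Suc M" if "upper1 p = Suc M"
  proof (rule ccontr)
    assume "upper2 p \<noteq> Suc M"
    with thresholds_step(3)[of p] have "upper2 p \<le> M"
      by auto
    with thresholds(3)[of M p] have "high p (l M)"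
      by simp
    then obtain r B where "p < r" "B \<le> M" "r = c B \<or> r = d B"
      by (auto simp: high_def)
    then have "p < h B" "h B \<le> h M"
      using hi_ge[of c B d] hi_ge[of d B c] h_mono[of B M] by auto
    then show False
      using thresholds(4)[of M p] that by simp
  qed
  have Y: "G dvd upper1 p \<and> upper1 p < M"
    using thresholds_step(4)[of p] X sum j by auto
  obtain g where g: "G = 2 * g"
    using even_G by blast
  obtain y where y: "upper1 p = 2 * (g * y)"
    using Y unfolding g dvd_def mult.assoc by blast
  \<comment> \<open>\<open>upper2 p\<close> may be the default \<open>Suc M\<close>; since
    \<open>G\<close> divides \<open>M\<close>, only an extra 1 remains, which the rounding
    absorbs.\<close>
  obtain x where x: "(upper2 p = 2 * (g * x) \<or> upper2 p = Suc (2 * (g * x))) \<and> 2 * (g * x) \<le> M"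
  proof (cases "upper2 p = Suc M")
    case True
    from G_dvd_M obtain x where "M = 2 * (g * x)"
      unfolding g dvd_def mult.assoc by blast
    with True that[of x] show thesis
      by simp
  next
    case False
    with thresholds_step(3)[of p] have "G dvd upper2 p" "upper2 p < M"
      by auto
    then obtain x where "upper2 p = 2 * (g * x)"
      unfolding g dvd_def mult.assoc by blast
    with \<open>upper2 p < M\<close> that[of x] show thesis
      by simp
  qed
  have eq: "Suc j = g * x + g * y"
    using sum x y by presburger
  then show "G div 2 dvd Suc j"
    using g by simp
  show "Suc j < M"
    using eq x y Y by linarith
qed

lemma stage_value_stepped: "stepped M (G div 2) \<rho> (stage_value M \<rho> c d)"
  using stage_value_mono stage_value_jump by (auto simp: stepped_def)

section \<open>Equilibrium and minimality of the bids in one turn\<close>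

lemma bids_affordable:
  assumes "j \<le> M"
  shows "j + m j \<le> M" "stage_bid1 M \<rho> c d j \<le> j"
proof -
  show "j + m j \<le> M"
  proof (cases "m j")
    case (Suc b)
    then show ?thesis
      using below_level_le(2)[OF assms, of b] by simp
  qed (use assms in simp)
  have "m j - 1 \<le> j" if "0 < m j"
    using below_level_le(1)[OF assms, of "m j - 1"] that by simp
  then show "stage_bid1 M \<rho> c d j \<le> j"
    using level_stops[OF assms]
    by (auto simp: stage_bid1_def bid2_wins_def stop1_def stop2_def Let_def)
qed

lemma bid2_wins_iff: "bid2_wins M \<rho> c d j \<longleftrightarrow> stage_bid1 M \<rho> c d j < m j"
  by (auto simp: stage_bid1_def bid2_wins_def stop2_def Let_def)

lemma bid1_level: "stage_bid1 M \<rho> c d j = m j \<or> 0 < m j \<and> stage_bid1 M \<rho> c d j = m j - 1"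
  by (auto simp: stage_bid1_def bid2_wins_def stop2_def Let_def)

lemma no_deviation1:
  assumes j: "j \<le> M"
  shows "b \<le> j \<Longrightarrow> m j \<le> b \<Longrightarrow> h (j - b) \<le> stage_value M \<rho> c d j"
    "b < m j \<Longrightarrow> l (j + m j) \<le> stage_value M \<rho> c d j"
proof -
  show "h (j - b) \<le> stage_value M \<rho> c d j" if "b \<le> j" "m j \<le> b"
  proof -
    have "h (j - b) \<le> h (j - m j)"
      using h_mono[of "j - b" "j - m j"] that j by simp
    moreover have "m j \<le> j"
      using that by simp
    ultimately show ?thesis
      by (auto simp: stage_value_def bid2_wins_def stop2_def Let_def)
  qed
  show "l (j + m j) \<le> stage_value M \<rho> c d j" if "b < m j"
    using that level_stops[OF j] bids_affordable(1)[OF j]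
    by (auto simp: stage_value_def bid2_wins_def stop2_def stop1_def Let_def)
qed

lemma no_deviation2:
  assumes j: "j \<le> M"
  shows "j + b \<le> M \<Longrightarrow> stage_bid1 M \<rho> c d j < b \<Longrightarrow> \<rho> (l (j + b)) \<le> \<rho> (stage_value M \<rho> c d j)"
    "b \<le> stage_bid1 M \<rho> c d j \<Longrightarrow>
      \<rho> (h (j - stage_bid1 M \<rho> c d j)) \<le> \<rho> (stage_value M \<rho> c d j)"
proof -
  show "\<rho> (l (j + b)) \<le> \<rho> (stage_value M \<rho> c d j)" if b: "j + b \<le> M" "stage_bid1 M \<rho> c d j < b"
  proof (cases "bid2_wins M \<rho> c d j")
    case True
    then have "m j \<le> b"
      using b(2) by (simp add: stage_bid1_def)
    with True l_mono[of "j + m j" "j + b"] b show ?thesis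
      by (simp add: stage_value_def)
  next
    case False
    then have "m j < b"
      using b(2) by (simp add: stage_bid1_def)
    with b have lb: "\<rho> (l (j + b)) \<le> \<rho> (l (Suc (j + m j)))" "Suc (j + m j) \<le> M"
      using l_mono[of "Suc (j + m j)" "j + b"] by auto
    have "\<rho> (l (Suc (j + m j))) \<le> \<rho> (h (j - m j))"
    proof (cases "S2 j (m j)")
      case True
      with False have "h (j - m j) = l (j + m j)"
        by (auto simp: bid2_wins_def Let_def)
      with l_mono[of "j + m j" "Suc (j + m j)"] lb show ?thesis
        by simp
    next
      case False
      with level_stops[OF j] lb show ?thesis
        by (auto simp: stop1_def)
    qed
    with lb False show ?thesis
      by (simp add: stage_value_def)
  qed
  show "\<rho> (h (j - stage_bid1 M \<rho> c d j)) \<le> \<rho> (stage_value M \<rho> c d j)"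
  proof (cases "bid2_wins M \<rho> c d j")
    case True
    then obtain b where b: "m j = Suc b"
      by (auto simp: bid2_wins_def stop2_def Let_def gr0_conv_Suc)
    with below_level_le(3)[OF j, of b] True show ?thesis
      by (simp add: stage_value_def stage_bid1_def)
  qed (simp add: stage_value_def stage_bid1_def)
qed

text \<open>\<open>up1\<close> and \<open>up2\<close> exclude gains from winning deviations.
  \<open>down1\<close> concerns only one child, since an underbidding agent 1 gets the state that
  agent 2 happens to choose. The alternatives spell out that the bids are greater than or equal to
  the bottom bids.\<close>

lemma stage_bids_least:
  assumes j: "j \<le> M" and x: "x1 \<le> j" "j + x2 \<le> M"
    and w: "x2 \<le> x1 \<Longrightarrow> w = h (j - x1)" "x1 < x2 \<Longrightarrow> w = l (j + x2)"
    and up1: "\<And>b. b \<le> j \<Longrightarrow> x2 \<le> b \<Longrightarrow> h (j - b) \<le> w"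
    and up2: "\<And>b. j + b \<le> M \<Longrightarrow> x1 < b \<Longrightarrow> \<rho> (l (j + b)) \<le> \<rho> w"
    and down1: "0 < x2 \<Longrightarrow> x2 \<le> x1 \<Longrightarrow> c (j + x2) \<le> w \<or> d (j + x2) \<le> w"
  shows "m j < max x1 x2 \<or>
    max x1 x2 = m j \<and> min x1 x2 < stage_bid1 M \<rho> c d j \<or>
    stage_bid1 M \<rho> c d j < m j \<and> x1 = m j \<and> x2 = stage_bid1 M \<rho> c d j \<or>
    x1 = stage_bid1 M \<rho> c d j \<and> x2 = m j"
proof -
  have "\<not> max x1 x2 < m j"
  proof
    assume less: "max x1 x2 < m j"
    show False
    proof (cases "x2 \<le> x1")
      case True
      with below_level_le[OF j, of x1] less up2[of "Suc x1"] w(1) show False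
        by simp
    next
      case False
      with below_level_less[OF j, of x2] below_level_le[OF j, of x2] less up1[of x2] w(2) show False
        by simp
    qed
  qed
  \<comment> \<open>The pair (m, m) would lie below (m - 1, m) in the order, so it has to be ruled
    out as an equilibrium.\<close>
  moreover have False if tie: "x1 = m j" "x2 = m j" "stage_bid1 M \<rho> c d j < m j"
  proof -
    have S2: "S2 j (m j)" "\<not> (m j \<le> j \<and> h (j - m j) = l (j + m j))"
      using tie(3) unfolding bid2_wins_iff[symmetric] by (auto simp: bid2_wins_def Let_def)
    have "h (j - m j) = l (j + m j)"
      using tie_at_level[OF j S2(1)] x tie w down1 up2[of "Suc (m j)"] by simp
    with S2 x tie show False
      by simp
  qed
  ultimately show ?thesis
    using bid1_level[of j] unfolding max_def min_def by (smt (verit) Suc_pred' Suc_leI leI le_antisym le_less_Suc_eq less_Suc_eq_le)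
qed

end

section \<open>The bottom equilibrium of the game\<close>

text \<open>Counting the strictly worse allocations codes the preference by numbers, with equal
  ranks exactly for equal outcomes.\<close>

definition rank :: "'a ssb \<Rightarrow> agent \<Rightarrow> 'a alloc \<Rightarrow> nat" where
  "rank F i t = card {t' \<in> terminals F. prefers F i t t'}"

text \<open>Well defined on ranks of terminals only, where it is injective.\<close>

definition rank_conv :: "'a ssb \<Rightarrow> nat \<Rightarrow> nat" where
  "rank_conv F x = rank F Ag2 (SOME t. t \<in> terminals F \<and> rank F Ag1 t = x)"

definition child :: "'a ssb \<Rightarrow> agent \<Rightarrow> 'a alloc \<Rightarrow> 'a alloc" where
  "child F i s = give (next_item F s) i s"

definition items_left :: "'a ssb \<Rightarrow> 'a alloc \<Rightarrow> nat" where
  "items_left F s = card (items F - allocated s)"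

primrec value_at :: "'a ssb \<Rightarrow> nat \<Rightarrow> nat \<Rightarrow> 'a alloc \<Rightarrow> nat \<Rightarrow> nat" where
  "value_at F M 0 s = (\<lambda>_. rank F Ag1 s)"
| "value_at F M (Suc n) s =
     stage_value M (rank_conv F) (value_at F M n (child F Ag1 s)) (value_at F M n (child F Ag2 s))"

definition state_value :: "'a ssb \<Rightarrow> nat \<Rightarrow> 'a alloc \<Rightarrow> nat \<Rightarrow> nat" where
  "state_value F M s = value_at F M (items_left F s) s"

lemma prefers_irrefl: "\<not> prefers F i t t"
  by (simp add: prefers_def)

lemma prefers_trans: "prefers F i t t' \<Longrightarrow> prefers F i t' t'' \<Longrightarrow> prefers F i t t''"
  by (auto simp: prefers_def)

lemma other_cases: "(\<forall>i. Q i) \<longleftrightarrow> Q (i::agent) \<and> Q (other i)"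
  by (cases i; metis agent.exhaust other.simps)

lemma prefers_linear: "prefers F i t t' \<or> same_outcome F t t' \<or> prefers F i t' t"
  by (auto simp: prefers_def same_outcome_def other_cases[where i = i])

lemma same_outcome_prefers:
  assumes "same_outcome F t t'"
  shows "prefers F i t u = prefers F i t' u" "prefers F i u t = prefers F i u t'"
  using assms by (auto simp: prefers_def same_outcome_def)

lemma next_states_eq: "next_states F s = {child F Ag1 s, child F Ag2 s}"
proof (intro equalityI subsetI)
  fix t assume "t \<in> next_states F s"
  then obtain i where "t = child F i s"
    by (auto simp: next_states_def child_def)
  then show "t \<in> {child F Ag1 s, child F Ag2 s}"
    by (cases i) auto
qed (auto simp: next_states_def child_def)

locale scrip_game =
  fixes F :: "'a ssb" and R :: nat
  assumes F: "ssb F" and R_even: "even R" and R_pos: "0 < R"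
begin

abbreviation k :: nat where "k \<equiv> card (items F)"
abbreviation M :: nat where "M \<equiv> R * 2 ^ k"
abbreviation left :: "'a alloc \<Rightarrow> nat" where "left \<equiv> items_left F"
abbreviation V :: "'a alloc \<Rightarrow> nat \<Rightarrow> nat" where "V \<equiv> state_value F M"
abbreviation r :: "'a alloc \<Rightarrow> nat" where "r \<equiv> rank F Ag1"
abbreviation \<rho> :: "nat \<Rightarrow> nat" where "\<rho> \<equiv> rank_conv F"

lemma M_pos: "0 < M"
  using R_pos by simp

lemma items_finite: "finite (items F)"
  using F by (simp add: ssb_def)

lemma length_tau: "length (tau F) = k"
  using F distinct_card[of "tau F"] by (simp add: ssb_def)

lemma terminals_finite: "finite (terminals F)"
proof -
  have "terminals F \<subseteq> (\<lambda>(A, B) i. case i of Ag1 \<Rightarrow> A | Ag2 \<Rightarrow> B) ` (Pow (items F) \<times> Pow (items F))"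
  proof
    fix t assume "t \<in> terminals F"
    then have "t Ag1 \<union> t Ag2 = items F"
      by (auto simp: terminals_def allocated_def)
    moreover have "t = (\<lambda>i. case i of Ag1 \<Rightarrow> t Ag1 | Ag2 \<Rightarrow> t Ag2)"
      by (auto simp: fun_eq_iff split: agent.split)
    ultimately show
      "t \<in> (\<lambda>(A, B) i. case i of Ag1 \<Rightarrow> A | Ag2 \<Rightarrow> B) ` (Pow (items F) \<times> Pow (items F))"
      by (intro image_eqI[of _ _ "(t Ag1, t Ag2)"]) auto
  qed
  then show ?thesis
    by (rule finite_subset) (simp add: items_finite)
qed

lemma rank_less:
  assumes "t' \<in> terminals F" "prefers F i t t'"
  shows "rank F i t' < rank F i t"
  unfolding rank_def
proof (rule psubset_card_mono)
  show "finite {u \<in> terminals F. prefers F i t u}"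
    using terminals_finite by simp
  show "{u \<in> terminals F. prefers F i t' u} \<subset> {u \<in> terminals F. prefers F i t u}"
    using assms prefers_irrefl prefers_trans by blast
qed

lemma rank_same: "same_outcome F t t' \<Longrightarrow> rank F i t = rank F i t'"
  by (simp add: rank_def same_outcome_prefers(1)[of F t t'])

lemma prefers_rank:
  assumes "t \<in> terminals F" "t' \<in> terminals F"
  shows "prefers F i t t' \<longleftrightarrow> rank F i t' < rank F i t"
  using rank_less[of t' i t] rank_less[of t i t'] rank_same[of t t' i] prefers_linear[of F i t t'] assms
  by (metis less_irrefl less_not_sym)

lemma same_outcome_rank:
  assumes "t \<in> terminals F" "t' \<in> terminals F"
  shows "same_outcome F t t' \<longleftrightarrow> rank F i t = rank F i t'"
  using rank_less[of t' i t] rank_less[of t i t'] rank_same[of t t' i] prefers_linear[of F i t t'] assms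
  by (metis less_irrefl)

lemma rank_conv:
  assumes t: "t \<in> terminals F"
  shows "\<rho> (r t) = rank F Ag2 t"
proof -
  let ?u = "SOME u. u \<in> terminals F \<and> r u = r t"
  have "?u \<in> terminals F \<and> r ?u = r t"
    using t someI[of "\<lambda>u. u \<in> terminals F \<and> r u = r t" t] by simp
  then have "same_outcome F ?u t"
    using same_outcome_rank[of ?u t Ag1] t by simp
  then show ?thesis
    unfolding rank_conv_def by (rule rank_same)
qed

lemma rank_conv_inj: "inj_on \<rho> (r ` terminals F)"
proof (rule inj_onI)
  fix x y assume "x \<in> r ` terminals F" "y \<in> r ` terminals F" and eq: "\<rho> x = \<rho> y"
  then obtain t u where tu: "t \<in> terminals F" "x = r t" "u \<in> terminals F" "y = r u"
    by auto
  with eq have "rank F Ag2 t = rank F Ag2 u"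
    by (simp add: rank_conv)
  with tu show "x = y"
    using same_outcome_rank[of t u Ag1] same_outcome_rank[of t u Ag2] by simp
qed

lemma weakly_prefers_rank:
  assumes "t \<in> terminals F" "t' \<in> terminals F"
  shows "weakly_prefers F Ag1 t t' \<longleftrightarrow> r t' \<le> r t"
    "weakly_prefers F Ag2 t t' \<longleftrightarrow> \<rho> (r t') \<le> \<rho> (r t)"
  unfolding weakly_prefers_def rank_conv[OF assms(1)] rank_conv[OF assms(2)]
    prefers_rank[OF assms] le_less
  using same_outcome_rank[OF assms, of Ag1] same_outcome_rank[OF assms, of Ag2] by metis+

section \<open>States, their children and the reachable allocations\<close>

lemma states_allocated:
  assumes "s \<in> states F"
  shows "allocated s = set (take (card (allocated s)) (tau F))" "card (allocated s) \<le> k"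
    "allocated s \<subseteq> items F"
proof -
  from assms obtain n where n: "n \<le> k" "allocated s = set (take n (tau F))"
    by (auto simp: states_def)
  then have "card (allocated s) = n"
    using F length_tau by (simp add: ssb_def distinct_card)
  with n show "allocated s = set (take (card (allocated s)) (tau F))" "card (allocated s) \<le> k"
    by auto
  from n show "allocated s \<subseteq> items F"
    using F set_take_subset[of n "tau F"] by (auto simp: ssb_def)
qed

lemma left_alt: "s \<in> states F \<Longrightarrow> left s = k - card (allocated s)"
  unfolding items_left_def using states_allocated(3)[of s] items_finite
  by (intro card_Diff_subset) (auto intro: finite_subset)

lemma terminal_iff: "s \<in> states F \<Longrightarrow> s \<in> terminals F \<longleftrightarrow> left s = 0"
  using states_allocated(3)[of s] items_finite
  by (auto simp: items_left_def terminals_def)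

lemma nonterminal_iff: "s \<in> nonterminals F \<longleftrightarrow> s \<in> states F \<and> left s \<noteq> 0"
  using terminal_iff[of s] by (auto simp: nonterminals_def)

lemma child_props:
  assumes "s \<in> nonterminals F"
  shows "next_item F s \<in> items F" "next_item F s \<notin> allocated s"
    "allocated (child F i s) = insert (next_item F s) (allocated s)"
    "child F i s \<in> states F" "left s = Suc (left (child F i s))"
proof -
  let ?n = "card (allocated s)" and ?x = "next_item F s"
  have s: "s \<in> states F" "left s \<noteq> 0"
    using assms nonterminal_iff by auto
  then have n: "?n < k"
    using left_alt[of s] by simp
  have dist: "distinct (tau F)"
    using F by (simp add: ssb_def)
  have all: "insert ?x (allocated s) = set (take (Suc ?n) (tau F))"
    using n length_tau states_allocated(1)[OF s(1)]
    by (simp add: take_Suc_conv_app_nth next_item_def)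
  show x: "?x \<in> items F"
    using n length_tau F nth_mem[of ?n "tau F"] by (simp add: next_item_def ssb_def)
  have "distinct (take (Suc ?n) (tau F))"
    using dist by simp
  then show notin: "?x \<notin> allocated s"
    using n length_tau states_allocated(1)[OF s(1)]
    by (simp add: take_Suc_conv_app_nth next_item_def)
  show alloc: "allocated (child F i s) = insert ?x (allocated s)"
    by (cases i) (auto simp: allocated_def child_def give_def)
  show "child F i s \<in> states F"
    unfolding states_def
  proof (intro CollectI conjI exI[of _ "Suc ?n"])
    show "child F i s Ag1 \<inter> child F i s Ag2 = {}"
      using s notin by (cases i) (auto simp: states_def child_def give_def allocated_def)
  qed (use n alloc all in auto)
  have "finite (items F - allocated s)" "?x \<in> items F - allocated s"
    using items_finite x notin by auto
  moreover have "items F - allocated (child F i s) = items F - allocated s - {?x}"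
    unfolding alloc by blast
  ultimately show "left s = Suc (left (child F i s))"
    unfolding items_left_def by (metis card_Suc_Diff1)
qed

lemma V_terminal: "s \<in> terminals F \<Longrightarrow> V s j = r s"
  using terminal_iff[of s] by (simp add: state_value_def terminals_def)

lemma V_nonterminal:
  "s \<in> nonterminals F \<Longrightarrow> V s = stage_value M \<rho> (V (child F Ag1 s)) (V (child F Ag2 s))"
  using child_props(5)[of s Ag1] child_props(5)[of s Ag2] by (simp add: state_value_def)

definition reachable :: "'a alloc \<Rightarrow> 'a alloc set" where
  "reachable s = {t \<in> terminals F. \<forall>i. s i \<subseteq> t i}"

lemma reachable_terminal:
  assumes "s \<in> terminals F"
  shows "reachable s = {s}"
proof -
  have "t = s" if "t \<in> terminals F" "\<forall>i. s i \<subseteq> t i" for t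
  proof
    fix i
    have "s Ag1 \<union> s Ag2 = t Ag1 \<union> t Ag2" "t Ag1 \<inter> t Ag2 = {}"
      using that assms by (auto simp: terminals_def states_def allocated_def)
    with that(2)[THEN spec, of Ag1] that(2)[THEN spec, of Ag2] show "t i = s i"
      by (cases i) auto
  qed
  with assms show ?thesis
    by (auto simp: reachable_def)
qed

lemma reachable_nonterminal:
  assumes "s \<in> nonterminals F"
  shows "reachable s = reachable (child F Ag1 s) \<union> reachable (child F Ag2 s)"
proof -
  have "t \<in> reachable (child F Ag1 s) \<union> reachable (child F Ag2 s)" if t: "t \<in> reachable s" for t
  proof -
    have "next_item F s \<in> t Ag1 \<union> t Ag2"
      using t child_props(1)[OF assms] by (auto simp: reachable_def terminals_def allocated_def)
    with t show ?thesis
      by (auto simp: reachable_def child_def give_def)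
  qed
  moreover have "reachable (child F i s) \<subseteq> reachable s" for i
    by (auto simp: reachable_def child_def give_def split: if_splits)
  ultimately show ?thesis
    by blast
qed

lemma reachable_init: "reachable init_state = terminals F"
  by (auto simp: reachable_def init_state_def)

lemma init_in_states: "init_state \<in> states F" "left init_state = k"
  by (auto simp: states_def init_state_def allocated_def items_left_def intro: exI[of _ 0])

lemma left_le: "left s \<le> k"
  unfolding items_left_def using items_finite by (simp add: card_mono)

abbreviation grid :: "'a alloc \<Rightarrow> nat" where "grid s \<equiv> R * 2 ^ (k - left s)"

lemma stageI:
  assumes "s \<in> nonterminals F"
    and inv: "\<And>i. stepped M (grid (child F i s)) \<rho> (V (child F i s))"
      "\<And>i. V (child F i s) ` {..M} = pareto_set \<rho> (r ` reachable (child F i s))"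
  shows "stage M (grid (child F Ag1 s)) \<rho> (V (child F Ag1 s)) (V (child F Ag2 s))"
proof
  have eq: "left (child F Ag2 s) = left (child F Ag1 s)"
    using child_props(5)[OF assms(1), of Ag1] child_props(5)[OF assms(1), of Ag2] by simp
  show "0 < M"
    by (rule M_pos)
  show "even (grid (child F Ag1 s))"
    using R_even by simp
  show "grid (child F Ag1 s) dvd M"
    by (intro mult_dvd_mono le_imp_power_dvd) auto
  show "stepped M (grid (child F Ag1 s)) \<rho> (V (child F Ag1 s))"
    by (rule inv)
  show "stepped M (grid (child F Ag1 s)) \<rho> (V (child F Ag2 s))"
    using inv(1)[of Ag2] by (simp add: eq)
  have "V (child F i s) ` {..M} \<subseteq> r ` terminals F" for i
    unfolding inv(2) using pareto_set_subset by (auto simp: reachable_def pareto_set_def)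
  then show "inj_on \<rho> (V (child F Ag1 s) ` {..M} \<union> V (child F Ag2 s) ` {..M})"
    by (intro inj_on_subset[OF rank_conv_inj]) blast
qed

lemma V_invariant:
  assumes "s \<in> states F"
  shows "stepped M (grid s) \<rho> (V s) \<and> V s ` {..M} = pareto_set \<rho> (r ` reachable s)"
  using assms
proof (induction "left s" arbitrary: s)
  case 0
  then have s: "s \<in> terminals F"
    by (simp add: terminal_iff)
  have "V s ` {..M} = {r s}"
    using V_terminal[OF s] by auto
  moreover have "pareto_set \<rho> {r s} = {r s}"
    by (auto simp: pareto_set_def)
  ultimately show ?case
    using V_terminal[OF s] reachable_terminal[OF s] by (simp add: stepped_def)
next
  case (Suc n)
  then have s: "s \<in> nonterminals F"
    by (simp add: nonterminal_iff)
  have IH: "stepped M (grid (child F i s)) \<rho> (V (child F i s))"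
    "V (child F i s) ` {..M} = pareto_set \<rho> (r ` reachable (child F i s))" for i
    using Suc.hyps(1)[of "child F i s"] Suc.hyps(2) child_props(4,5)[OF s, of i] by auto
  interpret stage M "grid (child F Ag1 s)" \<rho> "V (child F Ag1 s)" "V (child F Ag2 s)"
    by (rule stageI[OF s IH])
  have "k - left (child F Ag1 s) = Suc (k - left s)"
    using child_props(5)[OF s, of Ag1] left_le[of s] by simp
  then have g: "grid (child F Ag1 s) = 2 * grid s"
    by simp
  have "grid (child F Ag1 s) div 2 = grid s"
    unfolding g by simp
  then have "stepped M (grid s) \<rho> (V s)"
    using stage_value_stepped V_nonterminal[OF s] by simp
  moreover have "V s ` {..M} = pareto_set \<rho> (r ` reachable s)"
  proof -
    have fin: "finite (r ` reachable s)" for s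
      using terminals_finite by (simp add: reachable_def)
    have "inj_on \<rho> (r ` reachable s)"
      by (rule inj_on_subset[OF rank_conv_inj]) (auto simp: reachable_def)
    then show ?thesis
      using stage_value_onto pareto_set_Un[OF fin fin]
      unfolding V_nonterminal[OF s] IH reachable_nonterminal[OF s] image_Un by simp
  qed
  ultimately show ?case
    by blast
qed

lemma stage_child:
  "s \<in> nonterminals F \<Longrightarrow> stage M (grid (child F Ag1 s)) \<rho> (V (child F Ag1 s)) (V (child F Ag2 s))"
  using stageI V_invariant child_props(4) by blast


section \<open>Budgets as multiples of the unit\<close>

abbreviation \<epsilon> :: real where "\<epsilon> \<equiv> 1 / (real R * 2 ^ k)"

definition amt :: "nat \<Rightarrow> real" where "amt j = real j * \<epsilon>"
definition idx :: "real \<Rightarrow> nat" where "idx B = (THE j. amt j = B)"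

lemma eps_pos: "0 < \<epsilon>"
  using R_pos by simp

lemma amt_le [simp]: "amt i \<le> amt j \<longleftrightarrow> i \<le> j"
  unfolding amt_def using eps_pos by (simp only: mult_le_cancel_right_pos of_nat_le_iff)

lemma amt_eq [simp]: "amt i = amt j \<longleftrightarrow> i = j"
  by (simp add: order_eq_iff)

lemma amt_less [simp]: "amt i < amt j \<longleftrightarrow> i < j"
  by (simp add: less_le)

lemma idx_amt [simp]: "idx (amt j) = j"
  by (simp add: idx_def)

lemma amt_add: "amt i + amt j = amt (i + j)"
  by (simp only: amt_def of_nat_add distrib_right)

lemma amt_diff: "j \<le> i \<Longrightarrow> amt i - amt j = amt (i - j)"
  by (simp only: amt_def of_nat_diff left_diff_distrib)

lemma amt_M: "amt M = 1"
  using R_pos by (simp add: amt_def)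

lemma budgets_eq: "budgets \<epsilon> = amt ` {..M}"
proof -
  have "amt j \<le> 1 \<longleftrightarrow> j \<le> M" for j
    using amt_le[of j M] by (simp add: amt_M)
  then show ?thesis
    by (auto simp: budgets_def amt_def)
qed

lemma amt_budget [simp]: "j \<le> M \<Longrightarrow> amt j \<in> budgets \<epsilon>"
  by (simp add: budgets_eq)

lemma budget_of_amt:
  assumes "j \<le> M"
  shows "amt x \<le> budget_of Ag1 (amt j) \<longleftrightarrow> x \<le> j" "amt x \<le> budget_of Ag2 (amt j) \<longleftrightarrow> j + x \<le> M"
  using assms amt_diff[of j M] by (auto simp flip: amt_M)

lemma is_strategyD:
  assumes "is_strategy F \<epsilon> i \<sigma>" "s \<in> nonterminals F" "j \<le> M"
  obtains x where "bid \<sigma> s (amt j) = amt x" "x \<le> M" "amt x \<le> budget_of i (amt j)"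
    "dest \<sigma> s (amt j) \<in> next_states F s"
  using assms amt_budget[OF assms(3)] unfolding is_strategy_def budgets_eq by fastforce

lemma is_strategyI:
  assumes "\<And>s j. s \<in> nonterminals F \<Longrightarrow> j \<le> M \<Longrightarrow>
    \<exists>x\<le>M. bid \<sigma> s (amt j) = amt x \<and> amt x \<le> budget_of i (amt j) \<and> dest \<sigma> s (amt j) \<in> next_states F s"
  shows "is_strategy F \<epsilon> i \<sigma>"
  using assms unfolding is_strategy_def budgets_eq by fastforce

section \<open>Play and deviations\<close>

definition valid :: "'a profile \<Rightarrow> bool" where
  "valid \<gamma> \<longleftrightarrow> (\<forall>i. is_strategy F \<epsilon> i (\<gamma> i))"

lemma valid_upd: "valid \<gamma> \<Longrightarrow> is_strategy F \<epsilon> i \<sigma> \<Longrightarrow> valid (\<gamma>(i := \<sigma>))"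
  by (simp add: valid_def)

lemma next_stateD:
  assumes "s \<in> nonterminals F" "t \<in> next_states F s"
  shows "t \<in> states F" "left s = Suc (left t)"
  using assms child_props(4,5)[OF assms(1)] by (auto simp: next_states_eq)

lemma valid_bids:
  assumes "valid \<gamma>" "s \<in> nonterminals F" "j \<le> M"
  obtains x1 x2 where "bid (\<gamma> Ag1) s (amt j) = amt x1" "bid (\<gamma> Ag2) s (amt j) = amt x2"
    "x1 \<le> j" "j + x2 \<le> M"
    "dest (\<gamma> Ag1) s (amt j) \<in> next_states F s" "dest (\<gamma> Ag2) s (amt j) \<in> next_states F s"
proof -
  have "is_strategy F \<epsilon> Ag1 (\<gamma> Ag1)" "is_strategy F \<epsilon> Ag2 (\<gamma> Ag2)"
    using assms(1) by (auto simp: valid_def)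
  from is_strategyD[OF this(1) assms(2,3)] is_strategyD[OF this(2) assms(2,3)] show thesis
    using that budget_of_amt[OF assms(3)] by metis
qed

lemma outcome_terminal: "s \<in> terminals F \<Longrightarrow> outcome F \<gamma> s B = s"
  using terminal_iff[of s] by (simp add: outcome_def items_left_def terminals_def)

lemma outcome_step:
  assumes "s \<in> nonterminals F" "turn \<gamma> (s, B) = (t, B')" "t \<in> next_states F s"
  shows "outcome F \<gamma> s B = outcome F \<gamma> t B'"
proof -
  have "card (items F - allocated s) = Suc (card (items F - allocated t))"
    using next_stateD(2)[OF assms(1,3)] by (simp add: items_left_def)
  then show ?thesis
    using assms(2) by (simp add: outcome_def funpow_swap1[symmetric] del: turn.simps funpow.simps add: funpow_Suc_right)
qed

lemma outcome_bids:
  assumes "s \<in> nonterminals F" "j \<le> M"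
    and "bid (\<gamma> Ag1) s (amt j) = amt x1" "bid (\<gamma> Ag2) s (amt j) = amt x2" "x1 \<le> j"
  shows "x2 \<le> x1 \<Longrightarrow> dest (\<gamma> Ag1) s (amt j) \<in> next_states F s \<Longrightarrow>
      outcome F \<gamma> s (amt j) = outcome F \<gamma> (dest (\<gamma> Ag1) s (amt j)) (amt (j - x1))"
    "x1 < x2 \<Longrightarrow> dest (\<gamma> Ag2) s (amt j) \<in> next_states F s \<Longrightarrow>
      outcome F \<gamma> s (amt j) = outcome F \<gamma> (dest (\<gamma> Ag2) s (amt j)) (amt (j + x2))"
  using assms by (auto intro!: outcome_step simp: amt_diff amt_add)

lemma outcome_in_terminals:
  assumes "valid \<gamma>" "s \<in> states F" "j \<le> M"
  shows "outcome F \<gamma> s (amt j) \<in> terminals F"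
  using assms(2,3)
proof (induction "left s" arbitrary: s j)
  case 0
  then show ?case
    using terminal_iff outcome_terminal by simp
next
  case (Suc n)
  then have s: "s \<in> nonterminals F"
    by (simp add: nonterminal_iff)
  obtain x1 x2 where x: "bid (\<gamma> Ag1) s (amt j) = amt x1" "bid (\<gamma> Ag2) s (amt j) = amt x2"
    "x1 \<le> j" "j + x2 \<le> M"
    "dest (\<gamma> Ag1) s (amt j) \<in> next_states F s" "dest (\<gamma> Ag2) s (amt j) \<in> next_states F s"
    using valid_bids[OF assms(1) s Suc.prems(2)] .
  have IH: "outcome F \<gamma> t (amt i) \<in> terminals F" if "t \<in> next_states F s" "i \<le> M" for t i
    using Suc.hyps(1)[of t i] Suc.hyps(2) next_stateD[OF s that(1)] that(2) by simp
  show ?case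
    using outcome_bids[OF s Suc.prems(2) x(1-3)] x IH Suc.prems(2)
    by (cases "x2 \<le> x1") auto
qed

text \<open>Every turn lowers \<open>left\<close>, so play from \<open>s\<close> never consults
  states with more items left. Hence a deviation at one state does not affect the outcomes after
  it.\<close>

lemma outcome_cong:
  assumes "valid \<gamma>" "s \<in> states F" "j \<le> M"
    and "\<And>u i. left u \<le> left s \<Longrightarrow> bid (\<gamma>' i) u = bid (\<gamma> i) u \<and> dest (\<gamma>' i) u = dest (\<gamma> i) u"
  shows "outcome F \<gamma>' s (amt j) = outcome F \<gamma> s (amt j)"
  using assms(2-)
proof (induction "left s" arbitrary: s j)
  case 0
  then show ?case
    using terminal_iff outcome_terminal by simp
next
  case (Suc n)
  then have s: "s \<in> nonterminals F"
    by (simp add: nonterminal_iff)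
  obtain x1 x2 where x: "bid (\<gamma> Ag1) s (amt j) = amt x1" "bid (\<gamma> Ag2) s (amt j) = amt x2"
    "x1 \<le> j" "j + x2 \<le> M"
    "dest (\<gamma> Ag1) s (amt j) \<in> next_states F s" "dest (\<gamma> Ag2) s (amt j) \<in> next_states F s"
    using valid_bids[OF assms(1) s Suc.prems(2)] .
  have eq: "bid (\<gamma>' i) s = bid (\<gamma> i) s" "dest (\<gamma>' i) s = dest (\<gamma> i) s" for i
    using Suc.prems(3)[of s] by auto
  have IH: "outcome F \<gamma>' t (amt i) = outcome F \<gamma> t (amt i)" if "t \<in> next_states F s" "i \<le> M" for t i
    using Suc.hyps(1)[of t i] Suc.hyps(2) Suc.prems(3) next_stateD[OF s that(1)] that(2) by simp
  show ?case
  proof (cases "x2 \<le> x1")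
    case True
    with outcome_bids(1)[OF s Suc.prems(2) x(1-3) True] outcome_bids(1)[of s j \<gamma>' x1 x2] show ?thesis
      using s x IH Suc.prems(2) eq by simp
  next
    case False
    with outcome_bids(2)[OF s Suc.prems(2) x(1-3)] outcome_bids(2)[of s j \<gamma>' x1 x2] show ?thesis
      using s x IH Suc.prems(2) eq by simp
  qed
qed

lemma pspeD:
  assumes "pspe F \<epsilon> \<gamma>" "s \<in> states F" "j \<le> M"
  shows "valid \<gamma>"
    "is_strategy F \<epsilon> Ag1 \<sigma> \<Longrightarrow> r (outcome F (\<gamma>(Ag1 := \<sigma>)) s (amt j)) \<le> r (outcome F \<gamma> s (amt j))"
    "is_strategy F \<epsilon> Ag2 \<sigma> \<Longrightarrow>
      \<rho> (r (outcome F (\<gamma>(Ag2 := \<sigma>)) s (amt j))) \<le> \<rho> (r (outcome F \<gamma> s (amt j)))"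
proof -
  show v: "valid \<gamma>"
    using assms by (auto simp: pspe_def valid_def)
  have t: "outcome F \<gamma> s (amt j) \<in> terminals F"
    using outcome_in_terminals[OF v assms(2,3)] .
  have dev: "weakly_prefers F i (outcome F \<gamma> s (amt j)) (outcome F (\<gamma>(i := \<sigma>)) s (amt j))
      \<and> outcome F (\<gamma>(i := \<sigma>)) s (amt j) \<in> terminals F" if "is_strategy F \<epsilon> i \<sigma>" for i
    using assms that outcome_in_terminals[OF valid_upd[OF v that] assms(2,3)]
    by (auto simp: pspe_def)
  show "r (outcome F (\<gamma>(Ag1 := \<sigma>)) s (amt j)) \<le> r (outcome F \<gamma> s (amt j))"
    if "is_strategy F \<epsilon> Ag1 \<sigma>"
    using dev[OF that] weakly_prefers_rank(1)[OF t] by blast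
  show "\<rho> (r (outcome F (\<gamma>(Ag2 := \<sigma>)) s (amt j))) \<le> \<rho> (r (outcome F \<gamma> s (amt j)))"
    if "is_strategy F \<epsilon> Ag2 \<sigma>"
    using dev[OF that] weakly_prefers_rank(2)[OF t] by blast
qed

lemma pspeI:
  assumes v: "valid \<gamma>"
    and dev1: "\<And>s j \<sigma>. s \<in> states F \<Longrightarrow> j \<le> M \<Longrightarrow> is_strategy F \<epsilon> Ag1 \<sigma> \<Longrightarrow>
      r (outcome F (\<gamma>(Ag1 := \<sigma>)) s (amt j)) \<le> r (outcome F \<gamma> s (amt j))"
    and dev2: "\<And>s j \<sigma>. s \<in> states F \<Longrightarrow> j \<le> M \<Longrightarrow> is_strategy F \<epsilon> Ag2 \<sigma> \<Longrightarrow>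
      \<rho> (r (outcome F (\<gamma>(Ag2 := \<sigma>)) s (amt j))) \<le> \<rho> (r (outcome F \<gamma> s (amt j)))"
  shows "pspe F \<epsilon> \<gamma>"
  unfolding pspe_def
proof (intro conjI allI ballI impI)
  fix i show "is_strategy F \<epsilon> i (\<gamma> i)"
    using v by (simp add: valid_def)
next
  fix s B i \<sigma> assume s: "s \<in> states F" and B: "B \<in> budgets \<epsilon>" and \<sigma>: "is_strategy F \<epsilon> i \<sigma>"
  then obtain j where j: "j \<le> M" "B = amt j"
    by (auto simp: budgets_eq)
  have t: "outcome F \<gamma> s (amt j) \<in> terminals F" "outcome F (\<gamma>(i := \<sigma>)) s (amt j) \<in> terminals F"
    using outcome_in_terminals[OF v s j(1)] outcome_in_terminals[OF valid_upd[OF v \<sigma>] s j(1)] by auto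
  show "weakly_prefers F i (outcome F \<gamma> s B) (outcome F (\<gamma>(i := \<sigma>)) s B)"
    using weakly_prefers_rank[OF t] dev1[OF s j(1)] dev2[OF s j(1)] \<sigma> j(2) by (cases i) auto
qed

text \<open>A deviation at the single point \<open>(s, amt j)\<close>; such deviations suffice to
  bound the bids of an arbitrary equilibrium.\<close>

definition deviate :: "'a strategy \<Rightarrow> 'a alloc \<Rightarrow> nat \<Rightarrow> nat \<Rightarrow> 'a alloc \<Rightarrow> 'a strategy" where
  "deviate \<sigma> s j b t = \<lparr>bid = (bid \<sigma>)(s := (bid \<sigma> s)(amt j := amt b)),
     dest = (dest \<sigma>)(s := (dest \<sigma> s)(amt j := t))\<rparr>"

lemma deviate_strategy:
  assumes "is_strategy F \<epsilon> i \<sigma>" "t \<in> next_states F s" "b \<le> M" "amt b \<le> budget_of i (amt j)"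
  shows "is_strategy F \<epsilon> i (deviate \<sigma> s j b t)"
  using assms by (auto simp: is_strategy_def deviate_def)

lemma deviate_outcome:
  assumes "valid \<gamma>" "s \<in> nonterminals F" "t \<in> next_states F s" "j' \<le> M"
  shows "outcome F (\<gamma>(i := deviate (\<gamma> i) s j b u)) t (amt j') = outcome F \<gamma> t (amt j')"
  using next_stateD[OF assms(2,3)]
  by (intro outcome_cong assms) (auto simp: deviate_def)

lemma pspe_deviation1:
  assumes p: "pspe F \<epsilon> \<gamma>" and s: "s \<in> nonterminals F" and j: "j \<le> M"
    and x2: "bid (\<gamma> Ag2) s (amt j) = amt x2" and b: "b \<le> j" and t: "t \<in> next_states F s"
  shows "x2 \<le> b \<Longrightarrow> r (outcome F \<gamma> t (amt (j - b))) \<le> r (outcome F \<gamma> s (amt j))"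
    "b < x2 \<Longrightarrow> r (outcome F \<gamma> (dest (\<gamma> Ag2) s (amt j)) (amt (j + x2))) \<le> r (outcome F \<gamma> s (amt j))"
proof -
  let ?\<sigma> = "deviate (\<gamma> Ag1) s j b t"
  define \<gamma>' where "\<gamma>' = \<gamma>(Ag1 := ?\<sigma>)"
  have st: "s \<in> states F"
    using s nonterminal_iff by blast
  have v: "valid \<gamma>"
    using pspeD(1)[OF p st j] .
  have strat: "is_strategy F \<epsilon> Ag1 ?\<sigma>"
    using v t b j by (intro deviate_strategy) (auto simp: valid_def)
  have le: "r (outcome F \<gamma>' s (amt j)) \<le> r (outcome F \<gamma> s (amt j))"
    using pspeD(2)[OF p st j strat] unfolding \<gamma>'_def .
  have bids: "bid (\<gamma>' Ag1) s (amt j) = amt b" "bid (\<gamma>' Ag2) s (amt j) = amt x2"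
    "dest (\<gamma>' Ag1) s (amt j) = t"
    "dest (\<gamma>' Ag2) s (amt j) = dest (\<gamma> Ag2) s (amt j)"
    using x2 by (auto simp: deviate_def \<gamma>'_def)
  note step = outcome_bids[OF s j bids(1,2) b, unfolded bids(3,4)]
  show "r (outcome F \<gamma> t (amt (j - b))) \<le> r (outcome F \<gamma> s (amt j))" if "x2 \<le> b"
    using le step(1)[OF that t] deviate_outcome[OF v s t, of "j - b" Ag1 j b t, folded \<gamma>'_def] j by simp
  obtain y1 y2 where y: "bid (\<gamma> Ag2) s (amt j) = amt y2" "j + y2 \<le> M"
    "dest (\<gamma> Ag2) s (amt j) \<in> next_states F s"
    using valid_bids[OF v s j] by metis
  show "r (outcome F \<gamma> (dest (\<gamma> Ag2) s (amt j)) (amt (j + x2))) \<le> r (outcome F \<gamma> s (amt j))"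
    if "b < x2"
    using le step(2)[OF that y(3)] deviate_outcome[OF v s y(3), of "j + x2" Ag1 j b t, folded \<gamma>'_def] y x2 by simp
qed

text \<open>Only winning deviations are covered for agent 2; minimality uses losing deviations of
  agent 1 alone, to exclude the tie at the level.\<close>

lemma pspe_deviation2:
  assumes p: "pspe F \<epsilon> \<gamma>" and s: "s \<in> nonterminals F" and j: "j \<le> M"
    and x1: "bid (\<gamma> Ag1) s (amt j) = amt x1" and b: "j + b \<le> M" and t: "t \<in> next_states F s"
    and less: "x1 < b"
  shows "\<rho> (r (outcome F \<gamma> t (amt (j + b)))) \<le> \<rho> (r (outcome F \<gamma> s (amt j)))"
proof -
  let ?\<sigma> = "deviate (\<gamma> Ag2) s j b t"
  define \<gamma>' where "\<gamma>' = \<gamma>(Ag2 := ?\<sigma>)"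
  have st: "s \<in> states F"
    using s nonterminal_iff by blast
  have v: "valid \<gamma>"
    using pspeD(1)[OF p st j] .
  have strat: "is_strategy F \<epsilon> Ag2 ?\<sigma>"
    using v t b budget_of_amt(2)[OF j, of b] by (intro deviate_strategy) (auto simp: valid_def)
  have le: "\<rho> (r (outcome F \<gamma>' s (amt j))) \<le> \<rho> (r (outcome F \<gamma> s (amt j)))"
    using pspeD(3)[OF p st j strat] unfolding \<gamma>'_def .
  have bids: "bid (\<gamma>' Ag1) s (amt j) = amt x1" "bid (\<gamma>' Ag2) s (amt j) = amt b"
    "dest (\<gamma>' Ag2) s (amt j) = t"
    using x1 by (auto simp: deviate_def \<gamma>'_def)
  have "x1 \<le> j"
    using valid_bids[OF v s j] x1 by (metis amt_eq)
  note step = outcome_bids(2)[OF s j bids(1,2) this less, unfolded bids(3), OF t]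
  show ?thesis
    using le step deviate_outcome[OF v s t b, of Ag2 j b t, folded \<gamma>'_def] by simp
qed


section \<open>The bottom profile is an equilibrium\<close>

abbreviation VL :: "'a alloc \<Rightarrow> nat \<Rightarrow> nat" where "VL s \<equiv> V (child F Ag1 s)"
abbreviation VR :: "'a alloc \<Rightarrow> nat \<Rightarrow> nat" where "VR s \<equiv> V (child F Ag2 s)"
abbreviation hv :: "'a alloc \<Rightarrow> nat \<Rightarrow> nat" where "hv s \<equiv> hi (VL s) (VR s)"
abbreviation lv :: "'a alloc \<Rightarrow> nat \<Rightarrow> nat" where "lv s \<equiv> lo \<rho> (VL s) (VR s)"
abbreviation b1 :: "'a alloc \<Rightarrow> nat \<Rightarrow> nat" where "b1 s \<equiv> stage_bid1 M \<rho> (VL s) (VR s)"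
abbreviation b2 :: "'a alloc \<Rightarrow> nat \<Rightarrow> nat" where "b2 s \<equiv> level M \<rho> (VL s) (VR s)"

definition best1 :: "'a alloc \<Rightarrow> nat \<Rightarrow> 'a alloc" where
  "best1 s j = child F (if VR s j \<le> VL s j then Ag1 else Ag2) s"

definition best2 :: "'a alloc \<Rightarrow> nat \<Rightarrow> 'a alloc" where
  "best2 s j = child F (if \<rho> (VR s j) \<le> \<rho> (VL s j) then Ag1 else Ag2) s"

text \<open>The chosen states are optimal at the budget that results after the winning bid has been
  paid.\<close>

definition bottom :: "'a profile" where
  "bottom i = (case i of
     Ag1 \<Rightarrow> \<lparr>bid = \<lambda>s B. amt (b1 s (idx B)), dest = \<lambda>s B. best1 s (idx B - b1 s (idx B))\<rparr>
   | Ag2 \<Rightarrow> \<lparr>bid = \<lambda>s B. amt (b2 s (idx B)), dest = \<lambda>s B. best2 s (idx B + b2 s (idx B))\<rparr>)"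

lemma best_value: "V (best1 s j) j = hv s j" "V (best2 s j) j = lv s j"
  by (auto simp: best1_def best2_def hi_def lo_def)

lemma best_next: "best1 s j \<in> next_states F s" "best2 s j \<in> next_states F s"
  by (auto simp: best1_def best2_def next_states_eq)

lemma next_value:
  "t \<in> next_states F s \<Longrightarrow> V t j \<le> hv s j" "t \<in> next_states F s \<Longrightarrow> \<rho> (V t j) \<le> \<rho> (lv s j)"
  by (auto simp: next_states_eq hi_def lo_def)

lemma bottom_simps:
  "bid (bottom Ag1) s (amt j) = amt (b1 s j)" "bid (bottom Ag2) s (amt j) = amt (b2 s j)"
  "dest (bottom Ag1) s (amt j) = best1 s (j - b1 s j)"
  "dest (bottom Ag2) s (amt j) = best2 s (j + b2 s j)"
  by (simp_all add: bottom_def)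

lemma bottom_valid: "valid bottom"
  unfolding valid_def
proof
  fix i show "is_strategy F \<epsilon> i (bottom i)"
  proof (rule is_strategyI)
    fix s j assume s: "s \<in> nonterminals F" and j: "j \<le> M"
    note afford = stage.bids_affordable[OF stage_child[OF s] j]
    show "\<exists>x\<le>M. bid (bottom i) s (amt j) = amt x \<and> amt x \<le> budget_of i (amt j) \<and>
        dest (bottom i) s (amt j) \<in> next_states F s"
    proof (cases i)
      case Ag1
      with afford j show ?thesis
        by (intro exI[of _ "b1 s j"]) (simp add: bottom_simps best_next)
    next
      case Ag2
      with afford j budget_of_amt(2)[OF j] show ?thesis
        by (intro exI[of _ "b2 s j"]) (simp add: bottom_simps best_next)
    qed
  qed
qed

lemma bottom_value:
  assumes "s \<in> states F" "j \<le> M"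
  shows "r (outcome F bottom s (amt j)) = V s j"
  using assms
proof (induction "left s" arbitrary: s j)
  case 0
  then show ?case
    using terminal_iff outcome_terminal V_terminal by simp
next
  case (Suc n)
  then have s: "s \<in> nonterminals F"
    by (simp add: nonterminal_iff)
  interpret stage M "grid (child F Ag1 s)" \<rho> "VL s" "VR s"
    using stage_child[OF s] .
  have IH: "r (outcome F bottom t (amt i)) = V t i" if "t \<in> next_states F s" "i \<le> M" for t i
    using Suc.hyps(1)[of t i] Suc.hyps(2) next_stateD[OF s that(1)] that(2) by simp
  note afford = bids_affordable[OF Suc.prems(2)]
  note step = outcome_bids[OF s Suc.prems(2) bottom_simps(1,2) afford(2), unfolded bottom_simps]
  show ?case
  proof (cases "bid2_wins M \<rho> (VL s) (VR s) j")
    case True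
    then have "b1 s j < b2 s j"
      by (simp add: bid2_wins_iff)
    with step(2) afford True show ?thesis
      by (simp add: IH best_next best_value V_nonterminal[OF s] stage_value_def)
  next
    case False
    then have "b2 s j = b1 s j"
      by (simp add: stage_bid1_def)
    with step(1) afford False Suc.prems show ?thesis
      by (simp add: IH best_next best_value V_nonterminal[OF s] stage_value_def)
  qed
qed

text \<open>\<open>\<sigma>\<close> may differ everywhere. By induction no continuation is worth
  more to agent 1 than \<open>V\<close>, so the bounds for a single turn suffice.\<close>

lemma bottom_deviation1:
  assumes \<sigma>: "is_strategy F \<epsilon> Ag1 \<sigma>" and "s \<in> states F" "j \<le> M"
  shows "r (outcome F (bottom(Ag1 := \<sigma>)) s (amt j)) \<le> V s j"
  using assms(2,3)
proof (induction "left s" arbitrary: s j)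
  case 0
  then show ?case
    using terminal_iff outcome_terminal V_terminal by simp
next
  case (Suc n)
  then have s: "s \<in> nonterminals F"
    by (simp add: nonterminal_iff)
  define \<gamma> where "\<gamma> = bottom(Ag1 := \<sigma>)"
  have v: "valid \<gamma>"
    unfolding \<gamma>_def by (rule valid_upd[OF bottom_valid \<sigma>])
  interpret stage M "grid (child F Ag1 s)" \<rho> "VL s" "VR s"
    using stage_child[OF s] .
  have IH: "r (outcome F \<gamma> t (amt i)) \<le> V t i" if "t \<in> next_states F s" "i \<le> M" for t i
    using Suc.hyps(1)[of t i] Suc.hyps(2) next_stateD[OF s that(1)] that(2) by (simp add: \<gamma>_def)
  obtain x y where x: "bid (\<gamma> Ag1) s (amt j) = amt x" "x \<le> j" "dest (\<gamma> Ag1) s (amt j) \<in> next_states F s"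
    using valid_bids[OF v s Suc.prems(2)] by metis
  have ag2: "bid (\<gamma> Ag2) s (amt j) = amt (b2 s j)" "dest (\<gamma> Ag2) s (amt j) = best2 s (j + b2 s j)"
    by (simp_all add: \<gamma>_def bottom_simps)
  note step = outcome_bids[OF s Suc.prems(2) x(1) ag2(1) x(2), unfolded ag2(2)]
  have "r (outcome F \<gamma> s (amt j)) \<le> V s j"
  proof (cases "b2 s j \<le> x")
    case True
    have "r (outcome F \<gamma> s (amt j)) \<le> V (dest (\<gamma> Ag1) s (amt j)) (j - x)"
      using step(1)[OF True x(3)] IH[OF x(3), of "j - x"] Suc.prems(2) by simp
    also have "\<dots> \<le> hv s (j - x)"
      by (rule next_value(1)[OF x(3)])
    also have "\<dots> \<le> V s j"
      using no_deviation1(1)[OF Suc.prems(2) x(2) True] by (simp add: V_nonterminal[OF s])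
    finally show ?thesis .
  next
    case False
    then have less: "x < b2 s j"
      by simp
    have "r (outcome F \<gamma> s (amt j)) \<le> V (best2 s (j + b2 s j)) (j + b2 s j)"
      using step(2)[OF less best_next(2)] IH[OF best_next(2)] bids_affordable(1)[OF Suc.prems(2)] by simp
    also have "\<dots> \<le> V s j"
      using no_deviation1(2)[OF Suc.prems(2) less] by (simp add: best_value V_nonterminal[OF s])
    finally show ?thesis .
  qed
  then show ?case
    by (simp add: \<gamma>_def)
qed

lemma bottom_deviation2:
  assumes \<sigma>: "is_strategy F \<epsilon> Ag2 \<sigma>" and "s \<in> states F" "j \<le> M"
  shows "\<rho> (r (outcome F (bottom(Ag2 := \<sigma>)) s (amt j))) \<le> \<rho> (V s j)"
  using assms(2,3)
proof (induction "left s" arbitrary: s j)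
  case 0
  then show ?case
    using terminal_iff outcome_terminal V_terminal by simp
next
  case (Suc n)
  then have s: "s \<in> nonterminals F"
    by (simp add: nonterminal_iff)
  define \<gamma> where "\<gamma> = bottom(Ag2 := \<sigma>)"
  have v: "valid \<gamma>"
    unfolding \<gamma>_def by (rule valid_upd[OF bottom_valid \<sigma>])
  interpret stage M "grid (child F Ag1 s)" \<rho> "VL s" "VR s"
    using stage_child[OF s] .
  have IH: "\<rho> (r (outcome F \<gamma> t (amt i))) \<le> \<rho> (V t i)" if "t \<in> next_states F s" "i \<le> M" for t i
    using Suc.hyps(1)[of t i] Suc.hyps(2) next_stateD[OF s that(1)] that(2) by (simp add: \<gamma>_def)
  obtain x where x: "bid (\<gamma> Ag2) s (amt j) = amt x" "j + x \<le> M" "dest (\<gamma> Ag2) s (amt j) \<in> next_states F s"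
    using valid_bids[OF v s Suc.prems(2)] by metis
  have ag1: "bid (\<gamma> Ag1) s (amt j) = amt (b1 s j)" "dest (\<gamma> Ag1) s (amt j) = best1 s (j - b1 s j)"
    by (simp_all add: \<gamma>_def bottom_simps)
  note step = outcome_bids[OF s Suc.prems(2) ag1(1) x(1) bids_affordable(2)[OF Suc.prems(2)], unfolded ag1(2)]
  have "\<rho> (r (outcome F \<gamma> s (amt j))) \<le> \<rho> (V s j)"
  proof (cases "x \<le> b1 s j")
    case True
    have "\<rho> (r (outcome F \<gamma> s (amt j))) \<le> \<rho> (V (best1 s (j - b1 s j)) (j - b1 s j))"
      using step(1)[OF True best_next(1)] IH[OF best_next(1), of "j - b1 s j"] Suc.prems(2) by simp
    also have "\<dots> \<le> \<rho> (V s j)"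
      using no_deviation2(2)[OF Suc.prems(2) True] by (simp add: best_value V_nonterminal[OF s])
    finally show ?thesis .
  next
    case False
    then have less: "b1 s j < x"
      by simp
    have "\<rho> (r (outcome F \<gamma> s (amt j))) \<le> \<rho> (V (dest (\<gamma> Ag2) s (amt j)) (j + x))"
      using step(2)[OF less x(3)] IH[OF x(3,2)] by simp
    also have "\<dots> \<le> \<rho> (lv s (j + x))"
      by (rule next_value(2)[OF x(3)])
    also have "\<dots> \<le> \<rho> (V s j)"
      using no_deviation2(1)[OF Suc.prems(2) x(2) less] by (simp add: V_nonterminal[OF s])
    finally show ?thesis .
  qed
  then show ?case
    by (simp add: \<gamma>_def)
qed

lemma bottom_pspe: "pspe F \<epsilon> bottom"
  using bottom_deviation1 bottom_deviation2
  by (intro pspeI bottom_valid) (simp_all add: bottom_value)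

section \<open>Minimality among all equilibria\<close>

lemma pspe_stage:
  assumes p: "pspe F \<epsilon> \<gamma>" and s: "s \<in> nonterminals F" and j: "j \<le> M"
    and val: "\<And>t i. t \<in> next_states F s \<Longrightarrow> i \<le> M \<Longrightarrow> r (outcome F \<gamma> t (amt i)) = V t i"
  shows "bids_gt \<gamma> bottom s (amt j) \<or> bids_eq \<gamma> bottom s (amt j)"
    and "bids_eq \<gamma> bottom s (amt j) \<Longrightarrow> r (outcome F \<gamma> s (amt j)) = V s j"
proof -
  let ?w = "r (outcome F \<gamma> s (amt j))"
  interpret stage M "grid (child F Ag1 s)" \<rho> "VL s" "VR s"
    using stage_child[OF s] .
  have v: "valid \<gamma>"
    using pspeD(1)[OF p _ j] s nonterminal_iff by blast
  obtain x1 x2 where x: "bid (\<gamma> Ag1) s (amt j) = amt x1" "bid (\<gamma> Ag2) s (amt j) = amt x2"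
    "x1 \<le> j" "j + x2 \<le> M"
    and d: "dest (\<gamma> Ag1) s (amt j) \<in> next_states F s" "dest (\<gamma> Ag2) s (amt j) \<in> next_states F s"
    using valid_bids[OF v s j] .
  note step = outcome_bids[OF s j x(1-3)]
  have up1: "hv s (j - b) \<le> ?w" if "b \<le> j" "x2 \<le> b" for b
    using pspe_deviation1(1)[OF p s j x(2) that(1) best_next(1) that(2), of "j - b"] j
    by (simp add: val best_next best_value)
  have up2: "\<rho> (lv s (j + b)) \<le> \<rho> ?w" if "j + b \<le> M" "x1 < b" for b
    using pspe_deviation2[OF p s j x(1) that(1) best_next(2) that(2), of "j + b"] that
    by (simp add: val best_next best_value)
  have down1: "VL s (j + x2) \<le> ?w \<or> VR s (j + x2) \<le> ?w" if "0 < x2"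
    using pspe_deviation1(2)[OF p s j x(2) _ d(1) that] val[OF d(2) x(4)] d(2)
    by (auto simp: next_states_eq)
  have w1: "?w = hv s (j - x1)" if le: "x2 \<le> x1"
  proof (rule antisym)
    show "?w \<le> hv s (j - x1)"
      using step(1)[OF le d(1)] val[OF d(1), of "j - x1"] next_value(1)[OF d(1), of "j - x1"] j by simp
    show "hv s (j - x1) \<le> ?w"
      using up1[OF x(3) le] .
  qed
  \<comment> \<open>By \<open>up2\<close> at her own bid, agent 2's choice is as good for her as the
    optimal one; injectivity turns this into equality of outcomes.\<close>
  have w2: "?w = lv s (j + x2)" if less: "x1 < x2"
  proof (rule rho_eq)
    have w: "?w = V (dest (\<gamma> Ag2) s (amt j)) (j + x2)"
      using step(2)[OF less d(2)] val[OF d(2) x(4)] by simp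
    with d(2) x(4) show "?w \<in> T"
      by (auto simp: next_states_eq)
    show "lv s (j + x2) \<in> T"
      using in_T(4)[OF x(4)] .
    show "\<rho> ?w = \<rho> (lv s (j + x2))"
      using up2[OF x(4) less] next_value(2)[OF d(2), of "j + x2"] w by simp
  qed
  have min: "b2 s j < max x1 x2 \<or> max x1 x2 = b2 s j \<and> min x1 x2 < b1 s j \<or>
      b1 s j < b2 s j \<and> x1 = b2 s j \<and> x2 = b1 s j \<or> x1 = b1 s j \<and> x2 = b2 s j"
    using stage_bids_least[OF j x(3,4) w1 w2 up1 up2] down1 by blast
  have "b1 s j \<le> b2 s j"
    using bid1_level[of j] by linarith
  then have mx: "max (amt (b1 s j)) (amt (b2 s j)) = amt (b2 s j)"
    "min (amt (b1 s j)) (amt (b2 s j)) = amt (b1 s j)"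
    by (auto simp: max_def min_def)
  have mx': "max (amt x1) (amt x2) = amt (max x1 x2)" "min (amt x1) (amt x2) = amt (min x1 x2)"
    by (auto simp: max_def min_def)
  have eq_iff: "bids_eq \<gamma> bottom s (amt j) \<longleftrightarrow> x1 = b1 s j \<and> x2 = b2 s j"
    unfolding bids_eq_def other_cases[where i = Ag1] other.simps x(1,2) bottom_simps amt_eq ..
  have gt_iff: "bids_gt \<gamma> bottom s (amt j) \<longleftrightarrow>
      b2 s j < max x1 x2 \<or> max x1 x2 = b2 s j \<and> min x1 x2 < b1 s j \<or>
      x1 = b2 s j \<and> b1 s j < b2 s j \<and> b1 s j = x2"
    unfolding bids_gt_def Let_def x(1,2) bottom_simps mx mx' by simp
  show "bids_gt \<gamma> bottom s (amt j) \<or> bids_eq \<gamma> bottom s (amt j)"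
    unfolding eq_iff gt_iff using min by blast
  show "?w = V s j" if "bids_eq \<gamma> bottom s (amt j)"
  proof (cases "bid2_wins M \<rho> (VL s) (VR s) j")
    case True
    with that w2 show ?thesis
      unfolding eq_iff by (simp add: bid2_wins_iff V_nonterminal[OF s] stage_value_def)
  next
    case False
    with that w1 show ?thesis
      unfolding eq_iff by (simp add: stage_bid1_def V_nonterminal[OF s] stage_value_def)
  qed
qed

lemma subgame_eqD:
  assumes "subgame_eq F \<epsilon> \<gamma>' \<gamma> s" "s \<in> nonterminals F"
  shows "\<forall>t\<in>next_states F s. subgame_eq F \<epsilon> \<gamma>' \<gamma> t" "state_eq \<epsilon> \<gamma>' \<gamma> s"
  using assms by (auto simp: nonterminals_def elim: subgame_eq.cases)

text \<open>The second conjunct carries the induction: equal bids throughout a subgame force equal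
  values although the chosen states may differ. If some child is strictly greater, so is
  \<open>s\<close>, whatever is bid there.\<close>

lemma bottom_least:
  assumes p: "pspe F \<epsilon> \<gamma>" and "s \<in> states F"
  shows "(subgame_gt F \<epsilon> \<gamma> bottom s \<or> subgame_eq F \<epsilon> \<gamma> bottom s) \<and>
    (subgame_eq F \<epsilon> \<gamma> bottom s \<longrightarrow> (\<forall>j\<le>M. r (outcome F \<gamma> s (amt j)) = V s j))"
  using assms(2)
proof (induction "left s" arbitrary: s)
  case 0
  then have "s \<in> terminals F"
    by (simp add: terminal_iff)
  then show ?case
    by (simp add: subgame_eq.base outcome_terminal V_terminal)
next
  case (Suc n)
  then have s: "s \<in> nonterminals F"
    by (simp add: nonterminal_iff)
  have IH: "subgame_gt F \<epsilon> \<gamma> bottom t \<or> subgame_eq F \<epsilon> \<gamma> bottom t"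
    "subgame_eq F \<epsilon> \<gamma> bottom t \<Longrightarrow> i \<le> M \<Longrightarrow> r (outcome F \<gamma> t (amt i)) = V t i"
    if "t \<in> next_states F s" for t i
    using Suc.hyps(1)[of t] Suc.hyps(2) next_stateD[OF s that] by auto
  show ?case
  proof (cases "\<forall>t\<in>next_states F s. subgame_eq F \<epsilon> \<gamma> bottom t")
    case True
    note stage = pspe_stage[OF p s _ IH(2)[OF _ True[rule_format]]]
    have "state_gt \<epsilon> \<gamma> bottom s \<or> state_eq \<epsilon> \<gamma> bottom s"
      using stage(1) unfolding state_gt_def state_eq_def budgets_eq by auto
    then have "subgame_gt F \<epsilon> \<gamma> bottom s \<or> subgame_eq F \<epsilon> \<gamma> bottom s"
      using True s subgame_eq.step subgame_gt.step by blast
    moreover have "r (outcome F \<gamma> s (amt j)) = V s j" if "subgame_eq F \<epsilon> \<gamma> bottom s" "j \<le> M" for j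
      using subgame_eqD(2)[OF that(1) s] stage(2)[OF that(2)] that(2)
      unfolding state_eq_def budgets_eq by auto
    ultimately show ?thesis
      by blast
  next
    case False
    then have "subgame_gt F \<epsilon> \<gamma> bottom s"
      using IH(1) s subgame_gt.step by blast
    moreover have "\<not> subgame_eq F \<epsilon> \<gamma> bottom s"
      using False subgame_eqD(1)[OF _ s] by blast
    ultimately show ?thesis
      by blast
  qed
qed

lemma bottom_equilibrium: "bottom_equilibrium F \<epsilon> bottom"
  using bottom_pspe bottom_least[OF _ init_in_states(1)]
  unfolding bottom_equilibrium_def pi_ge_def by blast

section \<open>The outcome map\<close>

lemma mu_bottom:
  assumes "j \<le> M"
  shows "mu F bottom (amt j) \<in> terminals F" "r (mu F bottom (amt j)) = V init_state j"
  using outcome_in_terminals[OF bottom_valid init_in_states(1) assms]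
    bottom_value[OF init_in_states(1) assms] by (auto simp: mu_def)

lemma bottom_monotone: "monotone_map F \<epsilon> (mu F bottom)"
proof -
  have "stepped M (grid init_state) \<rho> (V init_state)"
    using V_invariant[OF init_in_states(1)] by blast
  note mono = steppedD(1,2)[OF this]
  show ?thesis
    unfolding monotone_map_def budgets_eq
    using mu_bottom weakly_prefers_rank mono by auto
qed

text \<open>What agent 1 strictly prefers to \<open>t\<close> is a different outcome, so agent 2 is
  not indifferent either: if she does not prefer it, she prefers \<open>t\<close>.\<close>

lemma pareto_efficient_rank:
  assumes "t \<in> terminals F"
  shows "t \<in> pareto_efficient F \<longleftrightarrow> r t \<in> pareto_set \<rho> (r ` terminals F)"
proof -
  have "r t \<in> pareto_set \<rho> (r ` terminals F) \<longleftrightarrow>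
      (\<forall>u\<in>terminals F. r t < r u \<longrightarrow> \<rho> (r u) < \<rho> (r t))"
    using assms by (auto simp: pareto_set_def)
  also have "\<dots> \<longleftrightarrow> (\<forall>u\<in>terminals F. prefers F Ag1 u t \<longrightarrow> prefers F Ag2 t u)"
    using assms by (simp add: prefers_rank rank_conv)
  also have "\<dots> \<longleftrightarrow> t \<in> pareto_efficient F"
    using assms prefers_linear[of F Ag2 t] prefers_irrefl prefers_trans same_outcome_prefers
    unfolding pareto_efficient_def mem_Collect_eq by metis
  finally show ?thesis ..
qed

lemma bottom_surjective: "surjective_map F \<epsilon> (mu F bottom) (pareto_efficient F)"
proof -
  have V: "V init_state ` {..M} = pareto_set \<rho> (r ` terminals F)"
    using V_invariant[OF init_in_states(1)] reachable_init by simp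
  have "mu F bottom (amt j) \<in> pareto_efficient F" if "j \<le> M" for j
    using pareto_efficient_rank[OF mu_bottom(1)[OF that]] mu_bottom(2)[OF that] V that by auto
  moreover have "\<exists>j\<le>M. same_outcome F (mu F bottom (amt j)) t" if t: "t \<in> pareto_efficient F" for t
  proof -
    have tt: "t \<in> terminals F"
      using t by (simp add: pareto_efficient_def)
    then obtain j where j: "j \<le> M" "V init_state j = r t"
      using t pareto_efficient_rank V by (metis atMost_iff imageE)
    then have "same_outcome F (mu F bottom (amt j)) t"
      using same_outcome_rank[OF mu_bottom(1)[OF j(1)] tt, of Ag1] mu_bottom(2)[OF j(1)] by simp
    with j show ?thesis
      by blast
  qed
  ultimately show ?thesis
    unfolding surjective_map_def budgets_eq by auto
qed

end

theorem theorem15: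
  fixes F :: "'a ssb" and R :: nat and \<epsilon> :: real
  assumes "ssb F"
    and "R \<ge> 4" and "even R"
    and "\<epsilon> = 1 / (real R * 2 ^ card (items F))"
  shows "\<exists>\<gamma>. bottom_equilibrium F \<epsilon> \<gamma> \<and>
             monotone_map F \<epsilon> (mu F \<gamma>) \<and>
             surjective_map F \<epsilon> (mu F \<gamma>) (pareto_efficient F)"
proof -
  interpret scrip_game F R
    using assms by unfold_locales auto
  show ?thesis
    unfolding assms(4) using bottom_equilibrium bottom_monotone bottom_surjective by blast
qed

end
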